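(* Let $K$ be a field and $S=K[x_1,\dots,x_n]$ with the standard grading. Let $p\geq 1$ and let $M$ be a finitely generated graded $S$-module with $\beta_p^{1,lin}(M)\neq 0$. Then $$\beta_i^{1,lin}(M)\geq \binom{p}{i}\quad\text{for } i=1,\dots,p.$$
   Context: For a finitely generated graded $S$-module $M\neq 0$, $\beta_{i,i+j}(M)=\dim_K \operatorname{Tor}^S_i(M,K)_{i+j}$ are the graded Betti numbers and $\operatorname{reg}(M)=\max\{j\in\mathbb{Z}: \beta_{i,i+j}(M)\neq 0 \text{ for some } i\in\mathbb{N}\}$ is the Castelnuovo-Mumford regularity. For $k\in\{0,\dots,n\}$ put $d_k(M)=\min(\{j\in\mathbb{Z}:\beta_{k,k+j}(M)\neq 0\}\cup\{\operatorname{reg}(M)\})$, and for $i\geq k$ put $\beta_i^{k,lin}(M)=\beta_{i,i+d_k(M)}(M)$. The claim uses $k=1$. *)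

theory Defs
  imports "HOL-Library.Poly_Mapping" Complex_Main
begin

text \<open>Polynomials over \<open>'k\<close> in the variables indexed by the finite (hence nonempty) type \<open>'n\<close>:
  finitely supported functions from exponent vectors to coefficients.\<close>

type_synonym ('k, 'n) mpoly = "('n \<Rightarrow>\<^sub>0 nat) \<Rightarrow>\<^sub>0 'k"

definition monom_degree :: "('n::finite \<Rightarrow>\<^sub>0 nat) \<Rightarrow> nat" where
  "monom_degree t = (\<Sum>x\<in>UNIV. Poly_Mapping.lookup t x)"

text \<open>The degree is an integer; for a negative degree only \<open>0\<close> qualifies.\<close>

definition homogeneous :: "int \<Rightarrow> ('k::field, 'n::finite) mpoly \<Rightarrow> bool" where
  "homogeneous e q \<longleftrightarrow> (\<forall>t\<in>Poly_Mapping.keys q. int (monom_degree t) = e)"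

definition const_coeff :: "('k::field, 'n::finite) mpoly \<Rightarrow> 'k" where
  "const_coeff q = Poly_Mapping.lookup q 0"

text \<open>The underlying set of the module is the whole type \<open>'m\<close>; \<open>gr j\<close> is its component of
  degree \<open>j\<close>. The last two assumptions say that the module is the direct sum of these.\<close>

locale graded_module = module scale
  for scale :: "('k::field, 'n::finite) mpoly \<Rightarrow> 'm::ab_group_add \<Rightarrow> 'm" +
  fixes gr :: "int \<Rightarrow> 'm set"
  assumes gr_zero: "0 \<in> gr j"
    and gr_add: "x \<in> gr j \<Longrightarrow> y \<in> gr j \<Longrightarrow> x + y \<in> gr j"
    and gr_uminus: "x \<in> gr j \<Longrightarrow> - x \<in> gr j"
    and gr_scale: "homogeneous e q \<Longrightarrow> x \<in> gr j \<Longrightarrow> scale q x \<in> gr (e + j)"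
    and gr_decompose: "\<exists>J f. finite J \<and> (\<forall>j\<in>J. f j \<in> gr j) \<and> x = sum f J"
    and gr_independent:
      "finite J \<Longrightarrow> (\<And>j. j \<in> J \<Longrightarrow> f j \<in> gr j) \<Longrightarrow> sum f J = 0 \<Longrightarrow> j \<in> J \<Longrightarrow> f j = 0"

definition finitely_generated :: "('a::comm_ring_1 \<Rightarrow> 'm::ab_group_add \<Rightarrow> 'm) \<Rightarrow> bool" where
  "finitely_generated scale \<longleftrightarrow> (\<exists>B. finite B \<and> module.span scale B = UNIV)"


text \<open>Elements of a free module of rank \<open>r\<close> over a ring \<open>'a\<close> are the finitely supported functions
  \<open>nat \<Rightarrow>\<^sub>0 'a\<close> whose support is contained in \<open>{..<r}\<close>.\<close>

definition vscale :: "'a::comm_ring_1 \<Rightarrow> (nat \<Rightarrow>\<^sub>0 'a) \<Rightarrow> (nat \<Rightarrow>\<^sub>0 'a)" where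
  "vscale c v = Poly_Mapping.map ((*) c) v"

definition free_mod :: "nat \<Rightarrow> (nat \<Rightarrow>\<^sub>0 'a::comm_ring_1) set" where
  "free_mod r = {v. Poly_Mapping.keys v \<subseteq> {..<r}}"

text \<open>The linear extension of the map sending the basis vector with number \<open>l\<close> to \<open>g l\<close>.\<close>

definition lin_ext ::
  "('a::comm_ring_1 \<Rightarrow> 'b::ab_group_add \<Rightarrow> 'b) \<Rightarrow> (nat \<Rightarrow> 'b) \<Rightarrow> (nat \<Rightarrow>\<^sub>0 'a) \<Rightarrow> 'b" where
  "lin_ext scale g v = (\<Sum>l\<in>Poly_Mapping.keys v. scale (Poly_Mapping.lookup v l) (g l))"

text \<open>The component of degree \<open>e\<close> of the graded free module \<open>S(-a 0) \<oplus> \<dots> \<oplus> S(-a (r - 1))\<close>,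
  whose basis vector with number \<open>l\<close> has degree \<open>a l\<close>.\<close>

definition free_comp ::
  "nat \<Rightarrow> (nat \<Rightarrow> int) \<Rightarrow> int \<Rightarrow> (nat \<Rightarrow>\<^sub>0 ('k::field, 'n::finite) mpoly) set" where
  "free_comp r a e =
     {v \<in> free_mod r. \<forall>l<r. homogeneous (e - a l) (Poly_Mapping.lookup v l)}"

text \<open>A graded free resolution \<open>\<dots> \<rightarrow> F\<^sub>2 \<rightarrow> F\<^sub>1 \<rightarrow> F\<^sub>0 \<rightarrow> M \<rightarrow> 0\<close> by free modules of finite rank,
  not necessarily minimal. The module \<open>F\<^sub>i\<close> has rank \<open>r i\<close> and its basis vector with number \<open>l\<close> has
  degree \<open>a i l\<close>. The augmentation sends that basis vector of \<open>F\<^sub>0\<close> to \<open>\<epsilon> l\<close>, and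
  the differential from \<open>F\<^sub>i\<^sub>+\<^sub>1\<close> to \<open>F\<^sub>i\<close> sends that basis vector of \<open>F\<^sub>i\<^sub>+\<^sub>1\<close> to \<open>d i l\<close> (note the index).\<close>

locale graded_free_resolution = graded_module scale gr
  for scale :: "('k::field, 'n::finite) mpoly \<Rightarrow> 'm::ab_group_add \<Rightarrow> 'm"
    and gr :: "int \<Rightarrow> 'm set" +
  fixes r :: "nat \<Rightarrow> nat"
    and a :: "nat \<Rightarrow> nat \<Rightarrow> int"
    and \<epsilon> :: "nat \<Rightarrow> 'm"
    and d :: "nat \<Rightarrow> nat \<Rightarrow> (nat \<Rightarrow>\<^sub>0 ('k, 'n) mpoly)"
  assumes aug_degree: "l < r 0 \<Longrightarrow> \<epsilon> l \<in> gr (a 0 l)"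
    and diff_degree: "l < r (Suc i) \<Longrightarrow> d i l \<in> free_comp (r i) (a i) (a (Suc i) l)"
    and aug_surj: "lin_ext scale \<epsilon> ` free_mod (r 0) = UNIV"
    and exact_0:
      "{v \<in> free_mod (r 0). lin_ext scale \<epsilon> v = 0} = lin_ext vscale (d 0) ` free_mod (r 1)"
    and exact_Suc:
      "{v \<in> free_mod (r (Suc i)). lin_ext vscale (d i) v = 0} =
         lin_ext vscale (d (Suc i)) ` free_mod (r (i + 2))"

text \<open>With \<open>K = S/(x\<^sub>1, \<dots>, x\<^sub>n)\<close>, the complex \<open>F \<otimes>\<^sub>S K\<close> consists of the vector spaces \<open>K\<^bsup>r i\<^esup>\<close>, the
  basis vector with number \<open>l\<close> having degree \<open>a i l\<close>; the matrices of its differentials are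
  obtained from those of \<open>F\<close> by reducing all entries modulo \<open>(x\<^sub>1, \<dots>, x\<^sub>n)\<close>, i.e. by taking
  constant coefficients.\<close>

definition tensor_comp :: "(nat \<Rightarrow> nat) \<Rightarrow> (nat \<Rightarrow> nat \<Rightarrow> int) \<Rightarrow> nat \<Rightarrow> int \<Rightarrow> (nat \<Rightarrow>\<^sub>0 'k::field) set"
  where "tensor_comp r a i e = {v \<in> free_mod (r i). \<forall>l\<in>Poly_Mapping.keys v. a i l = e}"

definition tensor_diff ::
  "(nat \<Rightarrow> nat \<Rightarrow> (nat \<Rightarrow>\<^sub>0 ('k::field, 'n::finite) mpoly)) \<Rightarrow> nat \<Rightarrow> (nat \<Rightarrow>\<^sub>0 'k) \<Rightarrow> (nat \<Rightarrow>\<^sub>0 'k)"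
  where "tensor_diff d i = lin_ext vscale (\<lambda>l. Poly_Mapping.map const_coeff (d i l))"

definition tor_cycles ::
  "(nat \<Rightarrow> nat) \<Rightarrow> (nat \<Rightarrow> nat \<Rightarrow> int) \<Rightarrow> (nat \<Rightarrow> nat \<Rightarrow> (nat \<Rightarrow>\<^sub>0 ('k::field, 'n::finite) mpoly)) \<Rightarrow>
     nat \<Rightarrow> int \<Rightarrow> (nat \<Rightarrow>\<^sub>0 'k) set" where
  "tor_cycles r a d i e =
     {v \<in> tensor_comp r a i e. case i of 0 \<Rightarrow> True | Suc h \<Rightarrow> tensor_diff d h v = 0}"

definition tor_boundaries ::
  "(nat \<Rightarrow> nat) \<Rightarrow> (nat \<Rightarrow> nat \<Rightarrow> int) \<Rightarrow> (nat \<Rightarrow> nat \<Rightarrow> (nat \<Rightarrow>\<^sub>0 ('k::field, 'n::finite) mpoly)) \<Rightarrow>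
     nat \<Rightarrow> int \<Rightarrow> (nat \<Rightarrow>\<^sub>0 'k) set" where
  "tor_boundaries r a d i e = tensor_diff d i ` tensor_comp r a (Suc i) e"

text \<open>The dimension of the homology \<open>Tor\<^sub>i(M, K)\<^sub>e\<close>, cycles modulo boundaries in degree \<open>e\<close>;
  both spaces are finite dimensional and the boundaries are cycles.\<close>

definition tor_dim ::
  "(nat \<Rightarrow> nat) \<Rightarrow> (nat \<Rightarrow> nat \<Rightarrow> int) \<Rightarrow> (nat \<Rightarrow> nat \<Rightarrow> (nat \<Rightarrow>\<^sub>0 ('k::field, 'n::finite) mpoly)) \<Rightarrow>
     nat \<Rightarrow> int \<Rightarrow> nat" where
  "tor_dim r a d i e =
     vector_space.dim vscale (tor_cycles r a d i e) -
     vector_space.dim vscale (tor_boundaries r a d i e)"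

text \<open>\<open>betti scale gr i e\<close> is \<open>\<beta>\<^sub>i\<^sub>,\<^sub>e\<close>, with \<open>e\<close> the total internal degree. It is computed
  from some graded free resolution; the result does not depend on the one chosen. A finitely
  generated graded module over the Noetherian ring \<open>S\<close> has such a resolution.\<close>

definition betti ::
  "(('k::field, 'n::finite) mpoly \<Rightarrow> 'm::ab_group_add \<Rightarrow> 'm) \<Rightarrow> (int \<Rightarrow> 'm set) \<Rightarrow>
     nat \<Rightarrow> int \<Rightarrow> nat" where
  "betti scale gr i e =
     (case SOME (r, a, \<epsilon>, d). graded_free_resolution scale gr r a \<epsilon> d of
        (r, a, \<epsilon>, d) \<Rightarrow> tor_dim r a d i e)"

definition regularity ::
  "(('k::field, 'n::finite) mpoly \<Rightarrow> 'm::ab_group_add \<Rightarrow> 'm) \<Rightarrow> (int \<Rightarrow> 'm set) \<Rightarrow> int" where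
  "regularity scale gr = Max {j. \<exists>i. betti scale gr i (int i + j) \<noteq> 0}"

definition lin_degree ::
  "(('k::field, 'n::finite) mpoly \<Rightarrow> 'm::ab_group_add \<Rightarrow> 'm) \<Rightarrow> (int \<Rightarrow> 'm set) \<Rightarrow> nat \<Rightarrow> int"
  where
  "lin_degree scale gr k =
     Min ({j. betti scale gr k (int k + j) \<noteq> 0} \<union> {regularity scale gr})"

definition lin_betti ::
  "(('k::field, 'n::finite) mpoly \<Rightarrow> 'm::ab_group_add \<Rightarrow> 'm) \<Rightarrow> (int \<Rightarrow> 'm set) \<Rightarrow>
     nat \<Rightarrow> nat \<Rightarrow> nat" where
  "lin_betti scale gr k i = betti scale gr i (int i + lin_degree scale gr k)"

lemma lookup_vscale [simp]: "Poly_Mapping.lookup (vscale c v) l = c * Poly_Mapping.lookup v l"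
  by (simp add: vscale_def Poly_Mapping.map.rep_eq when_def)

lemma module_vscale: "module vscale"
  by standard (auto intro!: poly_mapping_eqI simp: lookup_add algebra_simps)

lemma vector_space_vscale: "vector_space (vscale :: 'k::field \<Rightarrow> _)"
  by standard (auto intro!: poly_mapping_eqI simp: lookup_add algebra_simps)

end

theory Submission
  imports Defs "HOL-Library.Product_Lexorder" "HOL-Library.Multiset"
begin

text \<open>In a minimal resolution whose first syzygies have degree at least \<open>1 + d\<close>, let \<open>T\<^sub>i\<close> be spanned by
  the basis vectors of \<open>F\<^sub>i\<close> of degree \<open>i + d\<close>. The differential maps \<open>t \<in> T\<^sub>i\<close> to \<open>\<Sum>\<^sub>x x \<cdot> e\<^sub>x t\<close> with
  \<open>e\<^sub>x t \<in> T\<^sub>i\<^sub>-\<^sub>1\<close> for \<open>i \<ge> 2\<close>, and \<open>\<partial>\<partial> = 0\<close> makes the operators \<open>e\<^sub>x\<close> anticommute and square to \<open>0\<close>.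
  For \<open>0 \<noteq> t \<in> T\<^sub>p\<close> the elements \<open>\<partial> (e\<^sub>B t) \<in> F\<^sub>0\<close>, \<open>|B| = p - 1\<close>, therefore form a nonzero Koszul cycle
  with coefficients in a free module. Its part of largest multidegree is a monomial multiple of a simplicial
  cycle of dimension \<open>p - 2\<close>, which has at least as many faces with \<open>p - i\<close> vertices as the boundary
  of a \<open>(p - 1)\<close>-simplex, namely \<open>p choose i\<close>. For each such face \<open>D\<close> the element \<open>e\<^sub>D t \<in> T\<^sub>i\<close> has its own
  leading multidegree, so these elements are linearly independent.

  That the Betti numbers can be read off a minimal resolution rests on the existence of one (the ring is
  Noetherian, by Dickson's lemma) and on comparison maps being unique up to homotopy.\<close>

text \<open>The obstacle is the last differential. No degree bound holds for
  \<open>F\<^sub>0\<close>, so on \<open>T\<^sub>1\<close> the map \<open>\<partial>\<close> need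
  not have linear coefficients, and the operators stop at \<open>T\<^sub>1\<close>. The cycle in
  \<open>F\<^sub>0\<close> therefore has arbitrary polynomials as coefficients, and the module has
  no multigrading from which to separate them. The Koszul condition itself is multigraded, however:
  trading a letter of the face for the same variable in the coefficient keeps their product. A total
  order on exponents that is compatible with addition then isolates one multidegree. Of the cycle in
  that multidegree only the support matters. A single nonzero term cannot cancel, so every
  codimension-one face of a face in the support lies in a second one. This exchange property alone
  forces the face numbers of a simplex boundary. Signs thus never have to be computed: functions of
  lists that alternate up to sign replace oriented faces.\<close>

interpretation free: module "vscale :: 'a::comm_ring_1 \<Rightarrow> _"
  by (rule module_vscale)

lemma lookup_map [simp]:
  "f 0 = 0 \<Longrightarrow> Poly_Mapping.lookup (Poly_Mapping.map f v) l = f (Poly_Mapping.lookup v l)"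
  by (simp add: Poly_Mapping.map.rep_eq when_def)

lemma subspace_free_mod: "free.subspace (free_mod r)"
  unfolding free.subspace_def free_mod_def
proof (intro conjI ballI allI)
  fix v w :: "nat \<Rightarrow>\<^sub>0 'a" assume "v \<in> {v. Poly_Mapping.keys v \<subseteq> {..<r}}" "w \<in> {v. Poly_Mapping.keys v \<subseteq> {..<r}}"
  then show "v + w \<in> {v. Poly_Mapping.keys v \<subseteq> {..<r}}" using keys_add[of v w] by blast
next
  fix c and v :: "nat \<Rightarrow>\<^sub>0 'a" assume "v \<in> {v. Poly_Mapping.keys v \<subseteq> {..<r}}"
  moreover have "Poly_Mapping.keys (vscale c v) \<subseteq> Poly_Mapping.keys v" by (auto simp: in_keys_iff)
  ultimately show "vscale c v \<in> {v. Poly_Mapping.keys v \<subseteq> {..<r}}" by blast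
qed simp

section \<open>Linear extensions\<close>

context module
begin

lemma lin_ext_superset:
  assumes "finite A" "Poly_Mapping.keys v \<subseteq> A"
  shows "lin_ext scale g v = (\<Sum>l\<in>A. scale (Poly_Mapping.lookup v l) (g l))"
  unfolding lin_ext_def
  by (rule sum.mono_neutral_left) (use assms in \<open>auto simp: in_keys_iff\<close>)

lemma lin_ext_zero [simp]: "lin_ext scale g 0 = 0"
  by (simp add: lin_ext_def)

lemma lin_ext_add [simp]: "lin_ext scale g (v + w) = lin_ext scale g v + lin_ext scale g w"
proof -
  let ?A = "Poly_Mapping.keys v \<union> Poly_Mapping.keys w"
  have "Poly_Mapping.keys (v + w) \<subseteq> ?A" by (rule keys_add)
  then show ?thesis
    by (simp add: lin_ext_superset[of ?A] lookup_add scale_left_distrib sum.distrib)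
qed

lemma lin_ext_vscale [simp]: "lin_ext scale g (vscale c v) = scale c (lin_ext scale g v)"
proof -
  have "Poly_Mapping.keys (vscale c v) \<subseteq> Poly_Mapping.keys v"
    by (auto simp: in_keys_iff)
  then show ?thesis
    by (simp add: lin_ext_superset[of "Poly_Mapping.keys v"] scale_sum_right)
qed

lemma lin_ext_uminus [simp]: "lin_ext scale g (- v) = - lin_ext scale g v"
  using lin_ext_add[of g v "- v"] by (simp del: lin_ext_add add: eq_neg_iff_add_eq_0 add.commute)

lemma lin_ext_diff [simp]: "lin_ext scale g (v - w) = lin_ext scale g v - lin_ext scale g w"
  using lin_ext_add[of g v "- w"] by (simp del: lin_ext_add)

lemma lin_ext_sum: "lin_ext scale g (\<Sum>x\<in>X. f x) = (\<Sum>x\<in>X. lin_ext scale g (f x))"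
  by (induction X rule: infinite_finite_induct) auto

lemma lin_ext_single [simp]: "lin_ext scale g (Poly_Mapping.single l c) = scale c (g l)"
  by (simp add: lin_ext_def)

lemma lin_ext_cong:
  "(\<And>l. l \<in> Poly_Mapping.keys v \<Longrightarrow> g l = h l) \<Longrightarrow> lin_ext scale g v = lin_ext scale h v"
  by (simp add: lin_ext_def)

text \<open>Families such as \<open>\<epsilon>\<close> and \<open>d i\<close> carry no information
  at indices beyond the rank, so identities between linear extensions are available on
  \<open>free_mod r\<close> only.\<close>

lemma lin_ext_cong_free_mod:
  "v \<in> free_mod r \<Longrightarrow> (\<And>l. l < r \<Longrightarrow> g l = h l) \<Longrightarrow> lin_ext scale g v = lin_ext scale h v"
  by (rule lin_ext_cong) (auto simp: free_mod_def)

lemma lin_ext_minus_fun: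
  "lin_ext scale (\<lambda>l. g l - h l) v = lin_ext scale g v - lin_ext scale h v"
  by (simp add: lin_ext_def scale_right_diff_distrib sum_subtractf)

lemma lin_ext_comp:
  "lin_ext scale (\<lambda>l. lin_ext scale g (h l)) v = lin_ext scale g (lin_ext vscale h v)"
  by (simp add: lin_ext_def[of scale "\<lambda>l. lin_ext scale g (h l)"] lin_ext_def[of vscale h]
      lin_ext_sum)

lemma lin_ext_in_subspace:
  "subspace N \<Longrightarrow> (\<And>l. l \<in> Poly_Mapping.keys v \<Longrightarrow> g l \<in> N) \<Longrightarrow> lin_ext scale g v \<in> N"
  unfolding lin_ext_def by (intro subspace_sum subspace_scale)

lemma lin_ext_image_free_mod: "lin_ext scale g ` free_mod r = span (g ` {..<r})"
proof
  show "lin_ext scale g ` free_mod r \<subseteq> span (g ` {..<r})"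
    by (auto simp: free_mod_def intro!: lin_ext_in_subspace[OF subspace_span] intro: span_base)
  have sub: "subspace (lin_ext scale g ` free_mod r)"
    unfolding subspace_def
  proof (intro conjI ballI allI)
    show "0 \<in> lin_ext scale g ` free_mod r"
      using free.subspace_0[OF subspace_free_mod] by force
  next
    fix x y assume "x \<in> lin_ext scale g ` free_mod r" "y \<in> lin_ext scale g ` free_mod r"
    then obtain v w where "v \<in> free_mod r" "w \<in> free_mod r"
      "x = lin_ext scale g v" "y = lin_ext scale g w" by auto
    then show "x + y \<in> lin_ext scale g ` free_mod r"
      using free.subspace_add[OF subspace_free_mod, of v r w]
      by (intro image_eqI[of _ _ "v + w"]) auto
  next
    fix c x assume "x \<in> lin_ext scale g ` free_mod r"
    then obtain v where "v \<in> free_mod r" "x = lin_ext scale g v" by auto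
    then show "scale c x \<in> lin_ext scale g ` free_mod r"
      using free.subspace_scale[OF subspace_free_mod, of v r c]
      by (intro image_eqI[of _ _ "vscale c v"]) auto
  qed
  show "span (g ` {..<r}) \<subseteq> lin_ext scale g ` free_mod r"
  proof (rule span_minimal[OF _ sub], clarify)
    fix l assume "l < r"
    then show "g l \<in> lin_ext scale g ` free_mod r"
      by (intro image_eqI[of _ _ "Poly_Mapping.single l 1"]) (auto simp: free_mod_def)
  qed
qed

end

lemma lookup_lin_ext:
  "Poly_Mapping.lookup (lin_ext vscale g v) m =
     (\<Sum>l\<in>Poly_Mapping.keys v. Poly_Mapping.lookup v l * Poly_Mapping.lookup (g l) m)"
  by (simp add: lin_ext_def lookup_sum)

lemma lin_ext_single_one: "lin_ext vscale (\<lambda>l. Poly_Mapping.single l 1) v = v"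
proof (rule poly_mapping_eqI)
  fix m
  have "Poly_Mapping.lookup (lin_ext vscale (\<lambda>l. Poly_Mapping.single l 1) v) m =
      (\<Sum>l\<in>Poly_Mapping.keys v. if l = m then Poly_Mapping.lookup v l else 0)"
    unfolding lookup_lin_ext by (rule sum.cong) (auto simp: lookup_single when_def)
  also have "\<dots> = Poly_Mapping.lookup v m"
    by (auto simp: in_keys_iff)
  finally show "Poly_Mapping.lookup (lin_ext vscale (\<lambda>l. Poly_Mapping.single l 1) v) m =
      Poly_Mapping.lookup v m" .
qed

section \<open>Homogeneous polynomials and graded free modules\<close>

lemma monom_degree_zero [simp]: "monom_degree 0 = 0"
  by (simp add: monom_degree_def)

lemma monom_degree_add [simp]: "monom_degree (s + t) = monom_degree s + monom_degree t"
  by (simp add: monom_degree_def lookup_add sum.distrib)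

lemma monom_degree_single [simp]: "monom_degree (Poly_Mapping.single x n) = n"
  by (simp add: monom_degree_def lookup_single when_def)

lemma monom_degree_eq_0_iff [simp]: "monom_degree t = 0 \<longleftrightarrow> t = 0"
  by (auto simp: monom_degree_def intro: poly_mapping_eqI)

lemma monom_degree_eq_1D:
  assumes "monom_degree t = Suc 0"
  shows "\<exists>x. t = Poly_Mapping.single x 1"
proof -
  have "t \<noteq> 0" using assms by auto
  then obtain x where x: "Poly_Mapping.lookup t x \<noteq> 0"
    by (metis poly_mapping_eqI lookup_zero)
  have "t = Poly_Mapping.single x 1 + (t - Poly_Mapping.single x 1)"
    using x by (intro poly_mapping_eqI) (auto simp: lookup_add lookup_minus lookup_single when_def)
  moreover from this have "monom_degree (t - Poly_Mapping.single x 1) = 0"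
    using assms by (metis One_nat_def add_cancel_left_right monom_degree_add monom_degree_single)
  ultimately show ?thesis by (metis monom_degree_eq_0_iff add.right_neutral)
qed

lemma homogeneous_zero [simp]: "homogeneous e 0"
  by (simp add: homogeneous_def)

lemma homogeneous_add: "homogeneous e p \<Longrightarrow> homogeneous e q \<Longrightarrow> homogeneous e (p + q)"
  unfolding homogeneous_def using keys_add[of p q] by blast

lemma homogeneous_uminus: "homogeneous e p \<Longrightarrow> homogeneous e (- p)"
  by (simp add: homogeneous_def in_keys_iff)

lemma homogeneous_mult:
  assumes "homogeneous e p" "homogeneous f q"
  shows "homogeneous (e + f) (p * q)"
  unfolding homogeneous_def
proof
  fix t assume "t \<in> Poly_Mapping.keys (p * q)"
  then obtain a b where "t = a + b" "a \<in> Poly_Mapping.keys p" "b \<in> Poly_Mapping.keys q"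
    using keys_mult by blast
  with assms show "int (monom_degree t) = e + f" by (auto simp: homogeneous_def)
qed

lemma homogeneous_single [simp]: "int (monom_degree t) = e \<Longrightarrow> homogeneous e (Poly_Mapping.single t c)"
  by (simp add: homogeneous_def)

lemma homogeneous_one [simp]: "homogeneous 0 1"
  by (simp add: homogeneous_def)

lemma const_coeff_zero [simp]: "const_coeff 0 = 0"
  by (simp add: const_coeff_def)

lemma const_coeff_add [simp]: "const_coeff (p + q) = const_coeff p + const_coeff q"
  by (simp add: const_coeff_def lookup_add)

lemma const_coeff_diff [simp]: "const_coeff (p - q) = const_coeff p - const_coeff q"
  by (simp add: const_coeff_def lookup_minus)

lemma const_coeff_sum: "const_coeff (\<Sum>x\<in>X. f x) = (\<Sum>x\<in>X. const_coeff (f x))"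
  by (simp add: const_coeff_def lookup_sum)

lemma const_coeff_one [simp]: "const_coeff 1 = 1"
  by (simp add: const_coeff_def)

lemma exponent_sum_eq_0_iff: "(s :: 'n \<Rightarrow>\<^sub>0 nat) + t = 0 \<longleftrightarrow> s = 0 \<and> t = 0"
  by (auto simp: poly_mapping_eq_iff lookup_add fun_eq_iff)

lemma const_coeff_mult [simp]: "const_coeff (p * q) = const_coeff p * const_coeff q"
proof -
  have *: "0 = s + t \<longleftrightarrow> 0 = t \<and> s = 0" for s t :: "'b \<Rightarrow>\<^sub>0 nat"
    using exponent_sum_eq_0_iff[of s t] by metis
  have "(\<Sum>t. Poly_Mapping.lookup q t when 0 = s + t) = (const_coeff q when s = 0)" for s
    by (cases "s = 0") (simp_all add: * const_coeff_def)
  then show ?thesis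
    by (simp add: const_coeff_def[of "p * q"] lookup_mult mult_when) (simp add: const_coeff_def)
qed

text \<open>The exponent \<open>0\<close> has degree 0 and is alone in that degree. This yields the
  unit in the argument for minimal generators and makes degrees match after reduction.\<close>

lemma const_coeff_homogeneous:
  assumes "homogeneous e q" "const_coeff q \<noteq> 0"
  shows "e = 0" "q = Poly_Mapping.single 0 (const_coeff q)"
proof -
  have "0 \<in> Poly_Mapping.keys q" using assms(2) by (simp add: const_coeff_def in_keys_iff)
  then show e: "e = 0" using assms(1) by (auto simp: homogeneous_def)
  show "q = Poly_Mapping.single 0 (const_coeff q)"
  proof (rule poly_mapping_eqI)
    fix t
    show "Poly_Mapping.lookup q t = Poly_Mapping.lookup (Poly_Mapping.single 0 (const_coeff q)) t"
    proof (cases "t = 0")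
      case False
      then have "t \<notin> Poly_Mapping.keys q" using assms(1) e by (auto simp: homogeneous_def)
      with False show ?thesis by (simp add: in_keys_iff lookup_single_not_eq)
    qed (simp add: const_coeff_def)
  qed
qed

lemma lookup_single_mult [simp]:
  fixes s t :: "'n \<Rightarrow>\<^sub>0 nat" and q :: "('n \<Rightarrow>\<^sub>0 nat) \<Rightarrow>\<^sub>0 'k::field"
  shows "Poly_Mapping.lookup (Poly_Mapping.single s c * q) (s + t) = c * Poly_Mapping.lookup q t"
  by (simp add: lookup_mult lookup_single when_mult)

lemma lookup_single_mult_eq_0:
  fixes s t :: "'n \<Rightarrow>\<^sub>0 nat" and q :: "('n \<Rightarrow>\<^sub>0 nat) \<Rightarrow>\<^sub>0 'k::field"
  assumes "\<And>t'. t \<noteq> s + t'"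
  shows "Poly_Mapping.lookup (Poly_Mapping.single s c * q) t = 0"
proof (rule ccontr)
  assume "\<not> ?thesis"
  then have "t \<in> Poly_Mapping.keys (Poly_Mapping.single s c * q)" by (simp add: in_keys_iff)
  then show False using keys_mult[of "Poly_Mapping.single s c" q] assms
    by (auto split: if_splits)
qed

section \<open>Homogeneous components in graded free modules\<close>

definition graded_part :: "(nat \<Rightarrow> int) \<Rightarrow> int \<Rightarrow> (nat \<Rightarrow>\<^sub>0 ('k::field, 'n::finite) mpoly) \<Rightarrow>
    (nat \<Rightarrow>\<^sub>0 ('k, 'n) mpoly)" where
  "graded_part a e v =
     Poly_Mapping.mapp (\<lambda>l. Poly_Mapping.mapp (\<lambda>t c. c when a l + int (monom_degree t) = e)) v"

lemma lookup_graded_part: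
  "Poly_Mapping.lookup (Poly_Mapping.lookup (graded_part a e v) l) t =
     (Poly_Mapping.lookup (Poly_Mapping.lookup v l) t when a l + int (monom_degree t) = e)"
  by (auto simp: graded_part_def lookup_mapp when_def in_keys_iff)

lemma poly_mapping_eqI2:
  "(\<And>l t. Poly_Mapping.lookup (Poly_Mapping.lookup v l) t =
      Poly_Mapping.lookup (Poly_Mapping.lookup w l) t) \<Longrightarrow> v = w"
  by (intro poly_mapping_eqI) auto

lemma free_comp_eq:
  "free_comp r a e = {v :: nat \<Rightarrow>\<^sub>0 ('k::field, 'n::finite) mpoly. v \<in> free_mod r \<and> ( \<forall>l t. Poly_Mapping.lookup (Poly_Mapping.lookup v l) t \<noteq> 0
      \<longrightarrow> a l + int (monom_degree t) = e)}"
proof -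
  have "homogeneous (e - a l) (Poly_Mapping.lookup v l) \<longleftrightarrow>
      (\<forall>t. Poly_Mapping.lookup (Poly_Mapping.lookup v l) t \<noteq> 0 \<longrightarrow> a l + int (monom_degree t) = e)"
    for v :: "nat \<Rightarrow>\<^sub>0 ('k, 'n) mpoly" and l
    unfolding homogeneous_def in_keys_iff Ball_def by (intro all_cong1) linarith
  moreover have "Poly_Mapping.lookup v l = 0"
    if "v \<in> free_mod r" "\<not> l < r" for v :: "nat \<Rightarrow>\<^sub>0 ('k, 'n) mpoly" and l
    using that unfolding free_mod_def by (metis in_keys_iff lessThan_iff mem_Collect_eq subsetD)
  ultimately show ?thesis unfolding free_comp_def
    by (intro Collect_cong conj_cong refl) (metis lookup_zero)
qed

lemma free_comp_iff_graded_part: "v \<in> free_mod r \<Longrightarrow> v \<in> free_comp r a e \<longleftrightarrow> graded_part a e v = v"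
proof
  assume "v \<in> free_comp r a e"
  then show "graded_part a e v = v"
    by (intro poly_mapping_eqI2) (auto simp: free_comp_eq lookup_graded_part when_def)
next
  assume "v \<in> free_mod r" and *: "graded_part a e v = v"
  moreover have "a l + int (monom_degree t) = e"
    if "Poly_Mapping.lookup (Poly_Mapping.lookup v l) t \<noteq> 0" for l t
    using lookup_graded_part[of a e v l t] that unfolding * by (simp add: when_def split: if_splits)
  ultimately show "v \<in> free_comp r a e" by (simp add: free_comp_eq)
qed

lemma graded_part_zero [simp]: "graded_part a e 0 = 0"
  by (rule poly_mapping_eqI2) (simp add: lookup_graded_part)

lemma graded_part_add: "graded_part a e (v + w) = graded_part a e v + graded_part a e w"
  by (rule poly_mapping_eqI2) (simp add: lookup_graded_part lookup_add when_add_distrib)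

lemma graded_part_sum: "graded_part a e (\<Sum>x\<in>X. f x) = (\<Sum>x\<in>X. graded_part a e (f x))"
  by (induction X rule: infinite_finite_induct) (auto simp: graded_part_add)

lemma graded_part_eq_0: "v \<in> free_comp r a e' \<Longrightarrow> e \<noteq> e' \<Longrightarrow> graded_part a e v = 0"
  by (rule poly_mapping_eqI2) (auto simp: lookup_graded_part free_comp_eq when_def)

lemma graded_part_in_free_comp: "v \<in> free_mod r \<Longrightarrow> graded_part a e v \<in> free_comp r a e"
proof -
  assume v: "v \<in> free_mod r"
  have "Poly_Mapping.keys (graded_part a e v) \<subseteq> Poly_Mapping.keys v"
    unfolding graded_part_def by (rule keys_mapp_subset)
  with v have "graded_part a e v \<in> free_mod r"
    by (simp add: free_mod_def)
  then show ?thesis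
    by (simp add: free_comp_eq lookup_graded_part)
qed

lemma ex_graded_decomposition:
  "\<exists>J. finite J \<and> v = (\<Sum>e\<in>J. graded_part a e v)"
proof -
  define J where "J = (\<lambda>(l, t). a l + int (monom_degree t)) `
      (SIGMA l:Poly_Mapping.keys v. Poly_Mapping.keys (Poly_Mapping.lookup v l))"
  have fin: "finite J" by (auto simp: J_def)
  have "v = (\<Sum>e\<in>J. graded_part a e v)"
  proof (rule poly_mapping_eqI2)
    fix l t
    let ?c = "Poly_Mapping.lookup (Poly_Mapping.lookup v l) t"
    have "Poly_Mapping.lookup (Poly_Mapping.lookup (\<Sum>e\<in>J. graded_part a e v) l) t =
        (\<Sum>e\<in>J. if e = a l + int (monom_degree t) then ?c else 0)"
      by (simp add: lookup_sum lookup_graded_part when_def) (rule sum.cong, auto)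
    also have "\<dots> = ?c"
    proof (cases "?c = 0")
      case False
      then have "a l + int (monom_degree t) \<in> J"
        unfolding J_def by (intro image_eqI[of _ _ "(l, t)"]) (auto simp: in_keys_iff)
      with fin show ?thesis by simp
    qed (auto intro!: sum.neutral)
    finally show "?c = Poly_Mapping.lookup (Poly_Mapping.lookup (\<Sum>e\<in>J. graded_part a e v) l) t"
      by simp
  qed
  with fin show ?thesis by blast
qed

text \<open>This is \<open>graded_module\<close> without the decomposition axiom. A free module of
  rank \<open>r\<close> is a proper subset of its type, so \<open>free_comp r a\<close> cannot
  decompose the whole type. The weaker locale treats the augmentation and the differentials
  alike.\<close>

locale graded_target = module scale
  for scale :: "('k::field, 'n::finite) mpoly \<Rightarrow> 'm::ab_group_add \<Rightarrow> 'm" +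
  fixes gr :: "int \<Rightarrow> 'm set"
  assumes gr_zero: "0 \<in> gr j"
    and gr_add: "x \<in> gr j \<Longrightarrow> y \<in> gr j \<Longrightarrow> x + y \<in> gr j"
    and gr_uminus: "x \<in> gr j \<Longrightarrow> - x \<in> gr j"
    and gr_scale: "homogeneous e q \<Longrightarrow> x \<in> gr j \<Longrightarrow> scale q x \<in> gr (e + j)"
    and gr_independent:
      "finite J \<Longrightarrow> (\<And>j. j \<in> J \<Longrightarrow> f j \<in> gr j) \<Longrightarrow> sum f J = 0 \<Longrightarrow> j \<in> J \<Longrightarrow> f j = 0"
begin

lemma gr_sum: "(\<And>x. x \<in> X \<Longrightarrow> f x \<in> gr j) \<Longrightarrow> sum f X \<in> gr j"
  by (induction X rule: infinite_finite_induct) (auto simp: gr_zero gr_add)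

lemma gr_diff: "x \<in> gr j \<Longrightarrow> y \<in> gr j \<Longrightarrow> x - y \<in> gr j"
  using gr_add[of x j "- y"] gr_uminus[of y j] by simp

lemma lin_ext_in_gr:
  assumes "\<And>l. l < r \<Longrightarrow> g l \<in> gr (a l)" "v \<in> free_comp r a e"
  shows "lin_ext scale g v \<in> gr e"
  unfolding lin_ext_def
proof (rule gr_sum)
  fix l assume "l \<in> Poly_Mapping.keys v"
  with assms(2) have "l < r" by (auto simp: free_comp_def free_mod_def)
  with assms(2) have "homogeneous (e - a l) (Poly_Mapping.lookup v l)" by (auto simp: free_comp_def)
  from gr_scale[OF this assms(1)[OF \<open>l < r\<close>]]
  show "scale (Poly_Mapping.lookup v l) (g l) \<in> gr e" by simp
qed

text \<open>The images of the parts of \<open>v\<close> lie in different components of the target,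
  so independence kills all of them except the one of degree \<open>e\<close>.\<close>

lemma lin_ext_graded_part:
  assumes g: "\<And>l. l < r \<Longrightarrow> g l \<in> gr (a l)" and v: "v \<in> free_mod r"
    and e: "lin_ext scale g v \<in> gr e"
  shows "lin_ext scale g (graded_part a e v) = lin_ext scale g v"
proof -
  obtain J where J: "finite J" "v = (\<Sum>j\<in>J. graded_part a j v)"
    using ex_graded_decomposition by blast
  let ?J = "insert e J" and ?f = "\<lambda>j. lin_ext scale g (graded_part a j v)"
  have rest: "graded_part a e v = 0" if "e \<notin> J"
  proof -
    have "graded_part a e v = (\<Sum>j\<in>J. graded_part a e (graded_part a j v))"
      by (subst J(2)) (rule graded_part_sum)
    also have "\<dots> = 0"
      using that graded_part_eq_0[OF graded_part_in_free_comp[OF v]] by (intro sum.neutral) metis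
    finally show ?thesis .
  qed
  have "lin_ext scale g v = sum ?f J"
    by (subst J(2)) (rule lin_ext_sum)
  also have "\<dots> = sum ?f ?J"
    using J(1) rest by (cases "e \<in> J") (auto simp: insert_absorb)
  also have "\<dots> = ?f e + sum ?f (?J - {e})"
    using J(1) by (intro sum.remove) auto
  finally have total: "lin_ext scale g v = ?f e + sum ?f (?J - {e})" .
  \<comment> \<open>Moving the total to the other side, inside its own component, gives a family
    with sum 0, as \<open>gr_independent\<close> requires.\<close>
  define h where "h j = (if j = e then ?f e - lin_ext scale g v else ?f j)" for j
  have "sum h ?J = h e + sum h (?J - {e})"
    using J(1) by (intro sum.remove) auto
  also have "sum h (?J - {e}) = sum ?f (?J - {e})"
    by (rule sum.cong) (auto simp: h_def)
  finally have "sum h ?J = 0" using total by (simp add: h_def)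
  moreover have "h j \<in> gr j" for j
    using lin_ext_in_gr[OF g graded_part_in_free_comp[OF v]] e by (auto simp: h_def gr_diff)
  ultimately have "h e = 0"
    using gr_independent[of ?J h e] J(1) by simp
  then show ?thesis by (simp add: h_def)
qed

lemma homogeneous_preimage:
  assumes "\<And>l. l < r \<Longrightarrow> g l \<in> gr (a l)" "w \<in> gr e" "w \<in> lin_ext scale g ` free_mod r"
  obtains v where "v \<in> free_comp r a e" "lin_ext scale g v = w"
proof -
  from assms(3) obtain v where "v \<in> free_mod r" "w = lin_ext scale g v" by auto
  with assms(1,2) show ?thesis
    using that[of "graded_part a e v"] graded_part_in_free_comp[of v r a e]
      lin_ext_graded_part[of r g a v e]
    by simp
qed

end

lemma free_comp_in_free_mod: "v \<in> free_comp r a e \<Longrightarrow> v \<in> free_mod r"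
  by (simp add: free_comp_def)

lemma graded_target_free_comp:
  "graded_target (vscale :: ('k::field, 'n::finite) mpoly \<Rightarrow> _) (free_comp r a)"
proof (intro graded_target.intro graded_target_axioms.intro)
  show "module (vscale :: ('k, 'n) mpoly \<Rightarrow> _)" by (rule module_vscale)
next
  fix j show "0 \<in> free_comp r a j" by (simp add: free_comp_def free_mod_def)
next
  fix x y :: "nat \<Rightarrow>\<^sub>0 ('k, 'n) mpoly" and j
  assume "x \<in> free_comp r a j" "y \<in> free_comp r a j"
  then show "x + y \<in> free_comp r a j"
    using free.subspace_add[OF subspace_free_mod]
    by (auto simp: free_comp_def lookup_add homogeneous_add)
next
  fix x :: "nat \<Rightarrow>\<^sub>0 ('k, 'n) mpoly" and j
  assume "x \<in> free_comp r a j"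
  then show "- x \<in> free_comp r a j"
    using free.subspace_neg[OF subspace_free_mod]
    by (auto simp: free_comp_def homogeneous_uminus)
next
  fix e j and q :: "('k, 'n) mpoly" and x :: "nat \<Rightarrow>\<^sub>0 ('k, 'n) mpoly"
  assume "homogeneous e q" "x \<in> free_comp r a j"
  then show "vscale q x \<in> free_comp r a (e + j)"
    using free.subspace_scale[OF subspace_free_mod] homogeneous_mult[of e q]
    by (auto simp: free_comp_def add_diff_eq[symmetric])
next
  fix J and f :: "int \<Rightarrow> nat \<Rightarrow>\<^sub>0 ('k, 'n) mpoly" and j
  assume J: "finite J" and f: "\<And>j. j \<in> J \<Longrightarrow> f j \<in> free_comp r a j" and 0: "sum f J = 0"
    and j: "j \<in> J"
  have "0 = (\<Sum>i\<in>J. graded_part a j (f i))"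
    using arg_cong[OF 0, of "graded_part a j"] by (simp add: graded_part_sum)
  also have "\<dots> = graded_part a j (f j) + (\<Sum>i\<in>J-{j}. graded_part a j (f i))"
    using J j by (rule sum.remove)
  also have "(\<Sum>i\<in>J-{j}. graded_part a j (f i)) = 0"
    using graded_part_eq_0[OF f, of _ j] by (intro sum.neutral) auto
  also have "graded_part a j (f j) = f j"
    using f[OF j] free_comp_in_free_mod free_comp_iff_graded_part by blast
  finally show "f j = 0" by simp
qed

interpretation free_gr: graded_target "vscale :: ('k::field, 'n::finite) mpoly \<Rightarrow> _" "free_comp r a" for r a
  by (rule graded_target_free_comp)

sublocale graded_module \<subseteq> graded_target
  by unfold_locales (fact gr_zero gr_add gr_uminus gr_scale gr_independent)+

section \<open>A monomial order and Dickson's lemma\<close>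

definition var_index :: "'n::finite \<Rightarrow> nat" where
  "var_index = (SOME f. inj f)"

lemma inj_var_index: "inj var_index"
proof -
  have "\<exists>f :: 'a \<Rightarrow> nat. inj f"
    using finite_imp_inj_to_nat_seg[of "UNIV :: 'a set"] by auto
  then show ?thesis unfolding var_index_def by (rule someI_ex)
qed

text \<open>The type \<open>'n\<close> carries no order; renaming the variables to natural numbers gives access to
  the lexicographic order on exponent vectors.\<close>

definition lex_key :: "('n::finite \<Rightarrow>\<^sub>0 nat) \<Rightarrow> (nat \<Rightarrow>\<^sub>0 nat)" where
  "lex_key t = (\<Sum>x\<in>UNIV. Poly_Mapping.single (var_index x) (Poly_Mapping.lookup t x))"

lemma lookup_lex_key: "Poly_Mapping.lookup (lex_key t) (var_index x) = Poly_Mapping.lookup t x"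
proof -
  have "Poly_Mapping.lookup (lex_key t) (var_index x) =
      (\<Sum>y\<in>UNIV. if y = x then Poly_Mapping.lookup t y else 0)"
    unfolding lex_key_def lookup_sum
    by (rule sum.cong) (auto simp: lookup_single when_def dest: injD[OF inj_var_index])
  then show ?thesis by simp
qed

lemma lex_key_inject [simp]: "lex_key s = lex_key t \<longleftrightarrow> s = t"
  using lookup_lex_key by (metis poly_mapping_eqI)

lemma lex_key_add [simp]: "lex_key (s + t) = lex_key s + lex_key t"
  by (simp add: lex_key_def lookup_add single_add sum.distrib)

lemma lookup_le_monom_degree: "Poly_Mapping.lookup t x \<le> monom_degree t"
  unfolding monom_degree_def by (rule member_le_sum) simp_all

lemma finite_monom_degree_eq: "finite {t :: 'n::finite \<Rightarrow>\<^sub>0 nat. monom_degree t = D}"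
proof (rule finite_imageD)
  have "Poly_Mapping.lookup ` {t :: 'n \<Rightarrow>\<^sub>0 nat. monom_degree t = D} \<subseteq>
      {f. \<forall>x. (x \<in> UNIV \<longrightarrow> f x \<in> {..D}) \<and> (x \<notin> UNIV \<longrightarrow> f x = 0)}"
    by (auto intro: lookup_le_monom_degree)
  then show "finite (Poly_Mapping.lookup ` {t :: 'n \<Rightarrow>\<^sub>0 nat. monom_degree t = D})"
    by (rule finite_subset) (rule finite_set_of_finite_funs[OF finite_UNIV finite_atMost])
  show "inj_on Poly_Mapping.lookup {t :: 'n \<Rightarrow>\<^sub>0 nat. monom_degree t = D}"
    by (rule inj_onI) (rule poly_mapping_eqI, simp)
qed

text \<open>Every sequence has a monotone subsequence, and a nonincreasing one of natural numbers is
  constant from its minimum on.\<close>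

lemma ex_nondecreasing_subseq:
  fixes f :: "nat \<Rightarrow> nat"
  shows "\<exists>\<phi> :: nat \<Rightarrow> nat. strict_mono \<phi> \<and> mono (\<lambda>i. f (\<phi> i))"
proof -
  obtain \<phi> :: "nat \<Rightarrow> nat" where \<phi>: "strict_mono \<phi>" "monoseq (\<lambda>n. f (\<phi> n))"
    using seq_monosub by blast
  show ?thesis
  proof (cases "incseq (\<lambda>n. f (\<phi> n))")
    case False
    then have dec: "decseq (\<lambda>n. f (\<phi> n))" using \<phi>(2) by (auto simp: monoseq_iff)
    obtain N where N: "\<And>n. f (\<phi> N) \<le> f (\<phi> n)"
      using ex_has_least_nat[of "\<lambda>_. True" 0 "\<lambda>n. f (\<phi> n)"] by auto
    have "f (\<phi> (N + n)) = f (\<phi> N)" for n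
      using N[of "N + n"] decseqD[OF dec, of N "N + n"] by simp
    then have "mono (\<lambda>i. f (\<phi> (N + i)))" by (simp add: mono_def)
    moreover have "strict_mono (\<lambda>i. \<phi> (N + i))"
      using \<phi>(1) by (auto simp: strict_mono_def)
    ultimately show ?thesis by blast
  qed (use \<phi>(1) in blast)
qed

lemma ex_pointwise_nondecreasing_subseq:
  fixes f :: "nat \<Rightarrow> 'x \<Rightarrow> nat"
  assumes "finite A"
  shows "\<exists>\<phi> :: nat \<Rightarrow> nat. strict_mono \<phi> \<and> (\<forall>x\<in>A. mono (\<lambda>i. f (\<phi> i) x))"
  using assms
proof induction
  case empty
  show ?case by (auto intro: exI[of _ id] simp: strict_mono_def)
next
  case (insert x A)
  then obtain \<phi> :: "nat \<Rightarrow> nat" where \<phi>: "strict_mono \<phi>" "\<forall>x\<in>A. mono (\<lambda>i. f (\<phi> i) x)" by auto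
  obtain \<psi> :: "nat \<Rightarrow> nat" where \<psi>: "strict_mono \<psi>" "mono (\<lambda>i. f (\<phi> (\<psi> i)) x)"
    using ex_nondecreasing_subseq[of "\<lambda>i. f (\<phi> i) x"] by blast
  have "strict_mono (\<lambda>i. \<phi> (\<psi> i))" using \<phi>(1) \<psi>(1) by (simp add: strict_mono_def)
  moreover have "mono (\<lambda>i. f (\<phi> (\<psi> i)) y)" if "y \<in> A" for y
    using \<phi>(2) that strict_mono_mono[OF \<psi>(1)] by (auto simp: mono_def)
  ultimately show ?case using \<psi>(2) by (intro exI[of _ "\<lambda>i. \<phi> (\<psi> i)"]) auto
qed

text \<open>Otherwise one can keep choosing elements of \<open>L\<close> divisible by no earlier
  choice. A subsequence that is nondecreasing in every coordinate contradicts this at its first two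
  members.\<close>

lemma Dickson:
  fixes L :: "('n::finite \<Rightarrow>\<^sub>0 nat) set"
  shows "\<exists>L0\<subseteq>L. finite L0 \<and> (\<forall>t\<in>L. \<exists>t0\<in>L0. \<exists>s. t = t0 + s)"
proof (rule ccontr)
  assume "\<not> ?thesis"
  then have "\<forall>L0. \<exists>t. L0 \<subseteq> L \<and> finite L0 \<longrightarrow> t \<in> L \<and> (\<forall>t0\<in>L0. \<forall>s. t \<noteq> t0 + s)" by meson
  from choice[OF this] obtain g where g_all:
    "\<forall>L0. L0 \<subseteq> L \<and> finite L0 \<longrightarrow> g L0 \<in> L \<and> (\<forall>t0\<in>L0. \<forall>s. g L0 \<noteq> t0 + s)" ..
  then have g: "\<And>L0. L0 \<subseteq> L \<Longrightarrow> finite L0 \<Longrightarrow> g L0 \<in> L"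
    "\<And>L0 t0 s. L0 \<subseteq> L \<Longrightarrow> finite L0 \<Longrightarrow> t0 \<in> L0 \<Longrightarrow> g L0 \<noteq> t0 + s"
    by simp_all
  define A where "A = rec_nat {} (\<lambda>_ X. insert (g X) X)"
  have A: "A 0 = {}" "A (Suc n) = insert (g (A n)) (A n)" for n by (simp_all add: A_def)
  have fin: "A n \<subseteq> L \<and> finite (A n)" for n
    by (induction n) (simp_all add: A g(1))
  have mem: "g (A i) \<in> A j" if "i < j" for i j
    using that by (induction j) (auto simp: A less_Suc_eq)
  obtain \<phi> :: "nat \<Rightarrow> nat" where
    \<phi>: "strict_mono \<phi>" "\<And>x. mono (\<lambda>i. Poly_Mapping.lookup (g (A (\<phi> i))) x)"
    using ex_pointwise_nondecreasing_subseq[of UNIV "\<lambda>i. Poly_Mapping.lookup (g (A i))"] by auto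
  let ?s = "g (A (\<phi> 0))" and ?t = "g (A (\<phi> 1))"
  have "?t = ?s + (?t - ?s)"
    using monoD[OF \<phi>(2), of 0 1] by (intro poly_mapping_eqI) (simp add: lookup_add lookup_minus)
  moreover have "?s \<in> A (\<phi> 1)" using \<phi>(1) by (intro mem) (simp add: strict_mono_def)
  ultimately show False using g(2)[of "A (\<phi> 1)" ?s "?t - ?s"] fin by simp
qed

section \<open>Graded submodules of free modules are finitely generated\<close>

lemma finite_terms:
  "finite {(l, t). Poly_Mapping.lookup (Poly_Mapping.lookup v l) t \<noteq> 0}"
proof -
  have "{(l, t). Poly_Mapping.lookup (Poly_Mapping.lookup v l) t \<noteq> 0} =
      (SIGMA l:Poly_Mapping.keys v. Poly_Mapping.keys (Poly_Mapping.lookup v l))"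
    by (auto simp: in_keys_iff)
  then show ?thesis by (rule ssubst) (intro finite_SigmaI finite_keys)
qed

text \<open>A Groebner basis argument: by Dickson's lemma, finitely many homogeneous elements of
  \<open>N\<close> have leading terms that divide those of all homogeneous elements, and reduction
  by them keeps the degree. The components of an element of \<open>N\<close> lie in
  \<open>N\<close>, so homogeneous elements suffice.\<close>

lemma graded_submodule_finitely_generated:
  fixes N :: "(nat \<Rightarrow>\<^sub>0 ('k::field, 'n::finite) mpoly) set"
  assumes N: "free.subspace N" "N \<subseteq> free_mod r"
    and graded: "\<And>v e. v \<in> N \<Longrightarrow> graded_part a e v \<in> N"
  shows "\<exists>B. finite B \<and> B \<subseteq> (\<Union>e. N \<inter> free_comp r a e) \<and> free.span B = N"
proof -
  define coef :: "(nat \<Rightarrow>\<^sub>0 ('k, 'n) mpoly) \<Rightarrow> nat \<times> ('n \<Rightarrow>\<^sub>0 nat) \<Rightarrow> 'k"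
    where "coef v m = Poly_Mapping.lookup (Poly_Mapping.lookup v (fst m)) (snd m)" for v m
  \<comment> \<open>Position over term: the index of the basis vector is compared first, so
    Dickson's lemma can be applied to each index separately.\<close>
  define key :: "nat \<times> ('n \<Rightarrow>\<^sub>0 nat) \<Rightarrow> nat \<times> (nat \<Rightarrow>\<^sub>0 nat)"
    where "key m = (fst m, lex_key (snd m))" for m
  have key_inj: "key m = key m' \<longleftrightarrow> m = m'" for m m' by (auto simp: key_def prod_eq_iff)
  have key_shift: "key (l', s + t') \<le> key (l, s + t)" if "key (l', t') \<le> key (l, t)" for l l' s t t'
    using that by (auto simp: key_def less_eq_prod_def intro: add_left_mono)
  define top where "top v m \<longleftrightarrow> coef v m \<noteq> 0 \<and> (\<forall>m'. coef v m' \<noteq> 0 \<longrightarrow> key m' \<le> key m)" for v m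
  define H where "H = (\<Union>e. N \<inter> free_comp r a e)"
  define L where "L l = {t. \<exists>v\<in>H. top v (l, t)}" for l
  have "\<exists>L0. L0 \<subseteq> L l \<and> finite L0 \<and> (\<forall>t\<in>L l. \<exists>t0\<in>L0. \<exists>s. t = t0 + s)" for l
    using Dickson[of "L l"] by blast
  then obtain L0 where L0: "\<And>l. L0 l \<subseteq> L l" "\<And>l. finite (L0 l)"
    "\<And>l t. t \<in> L l \<Longrightarrow> \<exists>t0\<in>L0 l. \<exists>s. t = t0 + s" by metis
  have "\<forall>l t. \<exists>w. t \<in> L0 l \<longrightarrow> w \<in> H \<and> top w (l, t)"
    using L0(1) unfolding L_def by blast
  then obtain w where w: "\<And>l t. t \<in> L0 l \<Longrightarrow> w l t \<in> H \<and> top (w l t) (l, t)" by metis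
  define B where "B = (\<Union>l\<in>{..<r}. w l ` L0 l)"
  have B: "finite B" "B \<subseteq> H" using L0(2) w by (auto simp: B_def)
  have coef_degree: "fst m < r \<and> a (fst m) + int (monom_degree (snd m)) = e"
    if "v \<in> free_comp r a e" "coef v m \<noteq> 0" for v m e
  proof -
    have "fst m \<in> Poly_Mapping.keys v" using that(2) by (auto simp: coef_def in_keys_iff)
    with that show ?thesis by (auto simp: free_comp_eq free_mod_def coef_def)
  qed
  have hom: "v \<in> free.span B" if "v \<in> N" "v \<in> free_comp r a e" for v e
  proof -
    define D where "D = {m :: nat \<times> ('n \<Rightarrow>\<^sub>0 nat). fst m < r \<and> a (fst m) + int (monom_degree (snd m)) = e}"
    have "D \<subseteq> (SIGMA l:{..<r}. {t. monom_degree t = nat (e - a l)})" by (auto simp: D_def)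
    then have fin_D: "finite D" by (rule finite_subset) (simp add: finite_monom_degree_eq)
    \<comment> \<open>Measure for the reduction: the terms of degree \<open>e\<close> up to the
      leading one. Finiteness of \<open>D\<close> gives termination.\<close>
    define below where "below v = {m \<in> D. \<exists>m'. coef v m' \<noteq> 0 \<and> key m \<le> key m'}" for v
    show ?thesis using that
    proof (induction "card (below v)" arbitrary: v rule: less_induct)
      case less
      show ?case
      proof (cases "v = 0")
        case True
        then show ?thesis by (simp add: free.span_zero)
      next
        case False
        define T where "T = {m. coef v m \<noteq> 0}"
        have "T = {(l, t). Poly_Mapping.lookup (Poly_Mapping.lookup v l) t \<noteq> 0}"
          by (auto simp: T_def coef_def)
        then have T_fin: "finite T" using finite_terms[of v] by simp
        have "T \<noteq> {}"
        proof
          assume "T = {}"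
          then have "v = 0" by (intro poly_mapping_eqI2) (auto simp: T_def coef_def)
          with False show False by simp
        qed
        with T_fin have "Max (key ` T) \<in> key ` T" by simp
        then obtain l t where lt: "(l, t) \<in> T" "key (l, t) = Max (key ` T)"
          by (metis imageE surj_pair)
        then have top: "top v (l, t)"
          using T_fin by (auto simp: top_def T_def)
        have l: "l < r" "a l + int (monom_degree t) = e"
          using coef_degree[OF less.prems(2), of "(l, t)"] top by (auto simp: top_def)
        have "v \<in> H" using less.prems by (auto simp: H_def)
        then have "t \<in> L l" using top by (auto simp: L_def)
        then obtain t0 s where t0: "t0 \<in> L0 l" "t = t0 + s" using L0(3) by blast
        define u where "u = w l t0"
        have u: "u \<in> H" "top u (l, t0)" using w[OF t0(1)] by (auto simp: u_def)
        then obtain e0 where e0: "u \<in> N" "u \<in> free_comp r a e0" by (auto simp: H_def)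
        have "a l + int (monom_degree t0) = e0"
          using coef_degree[OF e0(2), of "(l, t0)"] u(2) by (auto simp: top_def)
        then have e: "e = int (monom_degree s) + e0" using l(2) t0(2) by simp
        \<comment> \<open>With the shift \<open>s\<close>, this scalar makes the leading terms of
          \<open>v\<close> and of the multiple of \<open>u\<close> cancel.\<close>
        define c where "c = coef v (l, t) / coef u (l, t0)"
        define v' where "v' = v - vscale (Poly_Mapping.single s c) u"
        have v': "v' \<in> N" "v' \<in> free_comp r a e"
          unfolding v'_def using less.prems e0
          by (auto simp: e intro!: free.subspace_diff[OF N(1)] free.subspace_scale[OF N(1)]
              free_gr.gr_diff free_gr.gr_scale)
        have coef_v': "coef v' (l', s + t') = coef v (l', s + t') - c * coef u (l', t')" for l' t'
          by (simp add: coef_def v'_def lookup_minus)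
        have coef_v'_0: "coef v' (l', t') = coef v (l', t')" if "\<And>t''. t' \<noteq> s + t''" for l' t'
          using that by (simp add: coef_def v'_def lookup_minus lookup_single_mult_eq_0)
        have smaller: "key m < key (l, t)" if m: "coef v' m \<noteq> 0" for m
        proof -
          obtain l' t' where [simp]: "m = (l', t')" by (cases m)
          have "key m \<le> key (l, t)"
          proof (cases "coef v m = 0")
            case True
            then obtain t'' where t'': "t' = s + t''"
              using m coef_v'_0[of t' l'] by (metis \<open>m = (l', t')\<close>)
            with True m coef_v' have "coef u (l', t'') \<noteq> 0" by auto
            then have "key (l', t'') \<le> key (l, t0)" using u(2) by (auto simp: top_def)
            from key_shift[OF this, of s] show ?thesis by (simp add: t'' t0(2) add.commute)
          qed (use top in \<open>auto simp: top_def\<close>)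
          moreover have "coef v' (l, t) = 0"
            using coef_v'[of l t0] u(2) by (simp add: t0(2) c_def top_def add.commute)
          then have "m \<noteq> (l, t)" using m by auto
          ultimately show ?thesis using key_inj by (metis order_le_less)
        qed
        have "below v' \<subseteq> below v"
        proof
          fix m assume "m \<in> below v'"
          then obtain m' where m': "m \<in> D" "coef v' m' \<noteq> 0" "key m \<le> key m'"
            unfolding below_def by blast
          from m'(3) smaller[OF m'(2)] have "key m \<le> key (l, t)" by simp
          with m'(1) top show "m \<in> below v" unfolding below_def top_def by blast
        qed
        moreover have "(l, t) \<in> below v" using l top by (auto simp: below_def D_def top_def)
        moreover have "(l, t) \<notin> below v'" using smaller by (fastforce simp: below_def not_le[symmetric])
        ultimately have "below v' \<subset> below v" by blast
        moreover have "finite (below v)" using fin_D by (simp add: below_def)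
        ultimately have "card (below v') < card (below v)" by (rule psubset_card_mono[rotated])
        with less.hyps v' have "v' \<in> free.span B" by blast
        moreover have "u \<in> free.span B"
          using t0(1) l(1) by (intro free.span_base) (auto simp: B_def u_def)
        ultimately have "v' + vscale (Poly_Mapping.single s c) u \<in> free.span B"
          by (intro free.span_add free.span_scale)
        then show ?thesis by (simp add: v'_def)
      qed
    qed
  qed
  have "N \<subseteq> free.span B"
  proof
    fix v assume v: "v \<in> N"
    obtain J where J: "v = (\<Sum>e\<in>J. graded_part a e v)"
      using ex_graded_decomposition by blast
    have "(\<Sum>e\<in>J. graded_part a e v) \<in> free.span B"
      using v N(2) graded by (intro free.span_sum hom[OF _ graded_part_in_free_comp]) auto
    then show "v \<in> free.span B" by (rule ssubst[OF J])
  qed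
  moreover have "free.span B \<subseteq> N"
    using B(2) by (intro free.span_minimal[OF _ N(1)]) (auto simp: H_def)
  ultimately show ?thesis using B unfolding H_def by blast
qed

section \<open>Minimal resolutions\<close>

text \<open>Dependent choice with an invariant \<open>P\<close>. The resolution, the comparison map
  and the homotopy are each built from it, as every stage can only be continued thanks to a property
  of the previous one.\<close>

lemma dependent_sequence:
  assumes "P 0 s0" "\<And>i s. P i s \<Longrightarrow> \<exists>s'. P (Suc i) s' \<and> Q i s s'"
  obtains S where "S 0 = s0" "\<And>i. P i (S i)" "\<And>i. Q i (S i) (S (Suc i))"
proof -
  define next_s where "next_s i s = (SOME s'. P (Suc i) s' \<and> Q i s s')" for i s
  define S where "S = rec_nat s0 next_s"
  have next_s: "P (Suc i) (next_s i s) \<and> Q i s (next_s i s)" if "P i s" for i s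
    unfolding next_s_def by (rule someI_ex) (rule assms(2)[OF that])
  have S: "S 0 = s0" "S (Suc i) = next_s i (S i)" for i by (simp_all add: S_def)
  have P: "P i (S i)" for i
    by (induction i) (simp_all add: S assms(1) next_s)
  show ?thesis
    by (rule that[of S]) (simp_all add: S P next_s)
qed

context graded_target
begin

lemma graded_kernel:
  assumes "\<And>l. l < r \<Longrightarrow> g l \<in> gr (a l)"
  defines "N \<equiv> {v \<in> free_mod r. lin_ext scale g v = 0}"
  shows "free.subspace N" and "\<And>v e. v \<in> N \<Longrightarrow> graded_part a e v \<in> N"
proof -
  show "free.subspace N"
    using free.subspace_0[OF subspace_free_mod[of r]] free.subspace_add[OF subspace_free_mod[of r]]
      free.subspace_scale[OF subspace_free_mod[of r]]
    by (auto simp: N_def free.subspace_def)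
  show "graded_part a e v \<in> N" if "v \<in> N" for v e
    using that lin_ext_graded_part[of r g a v e, OF assms(1)]
      free_comp_in_free_mod[OF graded_part_in_free_comp, of v r a e]
    by (auto simp: N_def gr_zero)
qed

text \<open>Take homogeneous generators of least number. In a homogeneous relation, a coefficient
  with nonzero constant part is a scalar, so its generator would be a combination of the others and
  could be dropped.\<close>

lemma ex_minimal_generators:
  assumes "finite B" "\<forall>b\<in>B. \<exists>e. b \<in> gr e"
  shows "\<exists>r a g. (\<forall>l<r. g l \<in> gr (a l)) \<and> lin_ext scale g ` free_mod r = span B \<and>
    (\<forall>e. \<forall>v\<in>free_comp r a e. lin_ext scale g v = 0 \<longrightarrow>
       (\<forall>l. const_coeff (Poly_Mapping.lookup v l) = 0))"
proof -
  define P where "P C \<longleftrightarrow> finite C \<and> (\<forall>b\<in>C. \<exists>e. b \<in> gr e) \<and> span C = span B" for C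
  have "P B" using assms by (simp add: P_def)
  from ex_has_least_nat[of P, OF this, of card] obtain C where
    PC: "P C" and least: "\<And>C'. P C' \<Longrightarrow> card C \<le> card C'" by auto
  then have C: "finite C" "\<forall>b\<in>C. \<exists>e. b \<in> gr e" "span C = span B" by (simp_all add: P_def)
  define r where "r = card C"
  obtain g where g: "bij_betw g {..<r} C"
    using ex_bij_betw_nat_finite[of C] C by (auto simp: r_def atLeast0LessThan)
  then have g_img: "g ` {..<r} = C" by (simp add: bij_betw_def)
  then have "\<forall>l. \<exists>e. l < r \<longrightarrow> g l \<in> gr e" using C by auto
  from choice[OF this] obtain a where a: "\<And>l. l < r \<Longrightarrow> g l \<in> gr (a l)" by auto
  have "const_coeff (Poly_Mapping.lookup v l) = 0"
    if v: "v \<in> free_comp r a e" "lin_ext scale g v = 0" for v e l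
  proof (rule ccontr)
    define c where "c = const_coeff (Poly_Mapping.lookup v l)"
    assume "const_coeff (Poly_Mapping.lookup v l) \<noteq> 0"
    then have c: "c \<noteq> 0" by (simp add: c_def)
    then have l: "l \<in> Poly_Mapping.keys v" by (auto simp: in_keys_iff c_def)
    then have "l < r" using v(1) by (auto simp: free_comp_def free_mod_def)
    then have vl: "Poly_Mapping.lookup v l = Poly_Mapping.single 0 c"
      using const_coeff_homogeneous(2)[of "e - a l" "Poly_Mapping.lookup v l"] v(1) c
      by (simp add: free_comp_def c_def)
    let ?rest = "\<Sum>m\<in>Poly_Mapping.keys v - {l}. scale (Poly_Mapping.lookup v m) (g m)"
    let ?D = "C - {g l}"
    have "0 = scale (Poly_Mapping.single 0 c) (g l) + ?rest"
      using v(2) l vl by (simp add: lin_ext_def sum.remove[where x = l])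
    then have "scale (Poly_Mapping.single 0 c) (g l) = - ?rest"
      by (metis eq_neg_iff_add_eq_0)
    then have "scale (Poly_Mapping.single 0 (1 / c)) (scale (Poly_Mapping.single 0 c) (g l)) =
        scale (Poly_Mapping.single 0 (1 / c)) (- ?rest)" by simp
    then have gl: "g l = scale (Poly_Mapping.single 0 (1 / c)) (- ?rest)"
      using c by (simp add: mult_single)
    have "?rest \<in> span ?D"
    proof (intro span_sum span_scale span_base)
      fix m assume m: "m \<in> Poly_Mapping.keys v - {l}"
      then have "m < r" using v(1) by (auto simp: free_comp_def free_mod_def)
      then show "g m \<in> ?D"
        using m g \<open>l < r\<close> by (auto simp: bij_betw_def dest: inj_onD)
    qed
    then have "g l \<in> span ?D" by (subst gl) (intro span_scale span_neg)
    then have "c \<in> span ?D" if "c \<in> C" for c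
      using that by (cases "c = g l") (auto intro: span_base)
    then have "C \<subseteq> span ?D" by (rule subsetI)
    then have "span C \<subseteq> span ?D" by (rule span_minimal) (rule subspace_span)
    moreover have "span ?D \<subseteq> span C" by (rule span_mono) auto
    ultimately have "span ?D = span C" by (rule equalityI[rotated])
    then have "card C \<le> card ?D" using C by (intro least) (simp add: P_def)
    moreover have "g l \<in> C" using \<open>l < r\<close> g_img by auto
    ultimately show False using C by (metis card_Diff1_less not_le)
  qed
  moreover have "lin_ext scale g ` free_mod r = span B"
    using C by (simp add: lin_ext_image_free_mod g_img)
  ultimately show ?thesis using a by (intro exI[of _ r] exI[of _ a] exI[of _ g]) simp
qed

end

locale minimal_graded_resolution = graded_free_resolution +
  assumes minimal: "l < r (Suc i) \<Longrightarrow> const_coeff (Poly_Mapping.lookup (d i l) m) = 0"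

context graded_module
begin

lemma ex_homogeneous_generators:
  assumes "finitely_generated scale"
  shows "\<exists>B. finite B \<and> (\<forall>b\<in>B. \<exists>e. b \<in> gr e) \<and> span B = UNIV"
proof -
  obtain B where B: "finite B" "span B = UNIV" using assms by (auto simp: finitely_generated_def)
  have "\<forall>x. \<exists>J. \<exists>f. finite J \<and> (\<forall>j\<in>J. f j \<in> gr j) \<and> x = sum f J"
    by (rule allI) (rule gr_decompose)
  from choice[OF this] obtain J where
    "\<forall>x. \<exists>f. finite (J x) \<and> (\<forall>j\<in>J x. f j \<in> gr j) \<and> x = sum f (J x)" ..
  from choice[OF this] obtain f where
    f: "\<forall>x. finite (J x) \<and> (\<forall>j\<in>J x. f x j \<in> gr j) \<and> x = sum (f x) (J x)" ..
  have Jf: "finite (J x)" "\<forall>j\<in>J x. f x j \<in> gr j" "x = sum (f x) (J x)" for x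
    using f by blast+
  let ?B = "\<Union>b\<in>B. f b ` J b"
  have "b \<in> span ?B" if "b \<in> B" for b
  proof -
    have "sum (f b) (J b) \<in> span ?B" using that by (intro span_sum span_base) auto
    then show ?thesis by (rule ssubst[OF Jf(3)[of b]])
  qed
  then have "span B \<subseteq> span ?B" by (intro span_minimal) auto
  then have "span ?B = UNIV" using B(2) by (intro equalityI subset_UNIV) (simp only:)
  moreover have "finite ?B" using B(1) Jf(1) by blast
  moreover have "\<forall>b\<in>?B. \<exists>e. b \<in> gr e" using Jf(2) by blast
  ultimately show ?thesis by (intro exI[of _ ?B] conjI)
qed

text \<open>Cover each kernel by minimal generators. Homogeneous elements of the next kernel are
  relations between these, so their coefficients have no constant part; the columns of the following
  differential are such elements.\<close>

theorem ex_minimal_graded_resolution: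
  assumes "finitely_generated scale"
  shows "\<exists>r a \<epsilon> d. minimal_graded_resolution scale gr r a \<epsilon> d"
proof -
  obtain B where B: "finite B" "\<forall>b\<in>B. \<exists>e. b \<in> gr e" "span B = UNIV"
    using ex_homogeneous_generators[OF assms] by (elim exE conjE) (rule that)
  obtain r0 a0 \<epsilon> where
    "(\<forall>l<r0. \<epsilon> l \<in> gr (a0 l)) \<and> lin_ext scale \<epsilon> ` free_mod r0 = UNIV \<and>
     (\<forall>e. \<forall>v\<in>free_comp r0 a0 e. lin_ext scale \<epsilon> v = 0 \<longrightarrow>
       (\<forall>l. const_coeff (Poly_Mapping.lookup v l) = 0))"
    using ex_minimal_generators[OF B(1,2)] unfolding B(3) by (elim exE) (rule that)
  then have \<epsilon>: "\<And>l. l < r0 \<Longrightarrow> \<epsilon> l \<in> gr (a0 l)" "lin_ext scale \<epsilon> ` free_mod r0 = UNIV"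
    and min0: "\<And>e v l. v \<in> free_comp r0 a0 e \<Longrightarrow> lin_ext scale \<epsilon> v = 0 \<Longrightarrow>
       const_coeff (Poly_Mapping.lookup v l) = 0"
    by blast+
  \<comment> \<open>A state is the current free module together with the kernel \<open>N\<close>
    still to be covered. The differential is left out of the state and selected afterwards from
    \<open>Q\<close>, which links two consecutive states.\<close>
  define P :: "nat \<times> (nat \<Rightarrow> int) \<times> (nat \<Rightarrow>\<^sub>0 ('k, 'n) mpoly) set \<Rightarrow> bool"
    where "P = (\<lambda>(r, a, N). free.subspace N \<and> N \<subseteq> free_mod r \<and>
      (\<forall>v\<in>N. \<forall>e. graded_part a e v \<in> N) \<and>
      (\<forall>e. \<forall>v\<in>N \<inter> free_comp r a e. \<forall>l. const_coeff (Poly_Mapping.lookup v l) = 0))"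
  define Q :: "nat \<times> (nat \<Rightarrow> int) \<times> (nat \<Rightarrow>\<^sub>0 ('k, 'n) mpoly) set \<Rightarrow>
      nat \<times> (nat \<Rightarrow> int) \<times> (nat \<Rightarrow>\<^sub>0 ('k, 'n) mpoly) set \<Rightarrow> (nat \<Rightarrow> (nat \<Rightarrow>\<^sub>0 ('k, 'n) mpoly)) \<Rightarrow> bool"
    where "Q = (\<lambda>(r, a, N) (r', a', N') g. (\<forall>l<r'. g l \<in> free_comp r a (a' l)) \<and>
      lin_ext vscale g ` free_mod r' = N \<and> N' = {v \<in> free_mod r'. lin_ext vscale g v = 0})"
  define s0 where "s0 = (r0, a0, {v \<in> free_mod r0. lin_ext scale \<epsilon> v = 0})"
  have P0: "P s0"
    using graded_kernel[of r0 \<epsilon> a0, OF \<epsilon>(1)] min0 by (auto simp: P_def s0_def)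
  have step: "\<exists>s'. P s' \<and> (\<exists>g. Q s s' g)" if Ps: "P s" for s
  proof -
    obtain r a N where s: "s = (r, a, N)" by (cases s)
    obtain B where B: "finite B" "B \<subseteq> (\<Union>e. N \<inter> free_comp r a e)" "free.span B = N"
      using graded_submodule_finitely_generated[of N r a] Ps by (auto simp: P_def s)
    have "\<forall>b\<in>B. \<exists>e. b \<in> free_comp r a e" using B(2) by auto
    note gens = free_gr.ex_minimal_generators[OF B(1) this, unfolded B(3)]
    from gens obtain r' a' g where
      "(\<forall>l<r'. g l \<in> free_comp r a (a' l)) \<and> lin_ext vscale g ` free_mod r' = N \<and>
       (\<forall>e. \<forall>v\<in>free_comp r' a' e. lin_ext vscale g v = 0 \<longrightarrow>
         (\<forall>l. const_coeff (Poly_Mapping.lookup v l) = 0))"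
      by (elim exE) (rule that)
    then have g: "\<And>l. l < r' \<Longrightarrow> g l \<in> free_comp r a (a' l)" "lin_ext vscale g ` free_mod r' = N"
      and min: "\<And>e v l. v \<in> free_comp r' a' e \<Longrightarrow> lin_ext vscale g v = 0 \<Longrightarrow>
         const_coeff (Poly_Mapping.lookup v l) = 0"
      by blast+
    have "P (r', a', {v \<in> free_mod r'. lin_ext vscale g v = 0})"
      using free_gr.graded_kernel[of r' g r a a', OF g(1)] min by (auto simp: P_def)
    moreover have "Q s (r', a', {v \<in> free_mod r'. lin_ext vscale g v = 0}) g"
      using g by (auto simp: Q_def s)
    ultimately show ?thesis by blast
  qed
  obtain S where S: "\<And>i. P (S i)" "\<And>i. \<exists>g. Q (S i) (S (Suc i)) g" "S 0 = s0"
    using dependent_sequence[of "\<lambda>_. P" s0 "\<lambda>_ s s'. \<exists>g. Q s s' g", OF P0 step] by metis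
  obtain d where d: "\<And>i. Q (S i) (S (Suc i)) (d i)" using S(2) by metis
  define r where "r i = fst (S i)" for i
  define a where "a i = fst (snd (S i))" for i
  define N where "N i = snd (snd (S i))" for i
  have S_eq: "S i = (r i, a i, N i)" for i by (simp add: r_def a_def N_def)
  have deg: "d i l \<in> free_comp (r i) (a i) (a (Suc i) l)" if "l < r (Suc i)" for i l
    using d[of i] that by (auto simp: Q_def S_eq)
  have img: "lin_ext vscale (d i) ` free_mod (r (Suc i)) = N i" for i
    using d[of i] by (simp add: Q_def S_eq)
  have ker: "N (Suc i) = {v \<in> free_mod (r (Suc i)). lin_ext vscale (d i) v = 0}" for i
    using d[of i] by (simp add: Q_def S_eq)
  have init: "r 0 = r0" "a 0 = a0" "N 0 = {v \<in> free_mod r0. lin_ext scale \<epsilon> v = 0}"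
    using S(3) by (auto simp: r_def a_def N_def s0_def)
  have min: "const_coeff (Poly_Mapping.lookup (d i l) m) = 0" if l: "l < r (Suc i)" for i l m
  proof -
    have "lin_ext vscale (d i) (Poly_Mapping.single l 1) \<in> N i"
      unfolding img[symmetric] using l by (intro imageI) (auto simp: free_mod_def)
    then have "d i l \<in> N i" by simp
    with deg[OF l] S(1)[of i] show ?thesis by (auto simp: P_def S_eq)
  qed
  have "minimal_graded_resolution scale gr r a \<epsilon> d"
  proof unfold_locales
    show "\<epsilon> l \<in> gr (a 0 l)" if "l < r 0" for l using \<epsilon>(1) that by (simp add: init)
    show "d i l \<in> free_comp (r i) (a i) (a (Suc i) l)" if "l < r (Suc i)" for i l
      using deg that .
    show "lin_ext scale \<epsilon> ` free_mod (r 0) = UNIV" using \<epsilon>(2) by (simp add: init)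
    show "{v \<in> free_mod (r 0). lin_ext scale \<epsilon> v = 0} = lin_ext vscale (d 0) ` free_mod (r 1)"
      using img[of 0] by (simp add: init)
    show "{v \<in> free_mod (r (Suc i)). lin_ext vscale (d i) v = 0} =
        lin_ext vscale (d (Suc i)) ` free_mod (r (i + 2))" for i
      using img[of "Suc i"] ker[of i] by simp
    show "const_coeff (Poly_Mapping.lookup (d i l) m) = 0" if "l < r (Suc i)" for i l m
      using min that .
  qed
  then show ?thesis by blast
qed

end

section \<open>Reduction modulo the irrelevant ideal\<close>

interpretation kvec: vector_space "vscale :: 'k::field \<Rightarrow> _"
  by (rule vector_space_vscale)

abbreviation reduce :: "(nat \<Rightarrow>\<^sub>0 ('k::field, 'n::finite) mpoly) \<Rightarrow> (nat \<Rightarrow>\<^sub>0 'k)" where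
  "reduce \<equiv> Poly_Mapping.map const_coeff"

text \<open>A section of \<open>reduce\<close>: it lifts vectors of \<open>F \<otimes> K\<close> to
  \<open>F\<close>, where exactness can be used.\<close>

abbreviation const_vec :: "(nat \<Rightarrow>\<^sub>0 'k::field) \<Rightarrow> (nat \<Rightarrow>\<^sub>0 ('k, 'n::finite) mpoly)" where
  "const_vec \<equiv> Poly_Mapping.map (Poly_Mapping.single 0)"

lemma reduce_zero [simp]: "reduce 0 = 0"
  by (rule poly_mapping_eqI) simp

lemma reduce_add: "reduce (v + w) = reduce v + reduce w"
  by (rule poly_mapping_eqI) (simp add: lookup_add)

lemma reduce_diff: "reduce (v - w) = reduce v - reduce w"
  by (rule poly_mapping_eqI) (simp add: lookup_minus)

lemma reduce_const_vec [simp]: "reduce (const_vec v) = v"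
  by (rule poly_mapping_eqI) (simp add: const_coeff_def)

lemma single_eq_0_iff [simp]: "Poly_Mapping.single k c = 0 \<longleftrightarrow> c = 0"
  by (metis lookup_single_eq lookup_zero single_zero)

lemma keys_const_vec [simp]: "Poly_Mapping.keys (const_vec v) = Poly_Mapping.keys v"
  by (simp add: set_eq_iff in_keys_iff)

lemma const_vec_in_free_mod [simp]: "const_vec v \<in> free_mod r \<longleftrightarrow> v \<in> free_mod r"
  by (simp add: free_mod_def)

lemma reduce_lin_ext: "reduce (lin_ext vscale g v) = lin_ext vscale (\<lambda>l. reduce (g l)) (reduce v)"
proof (rule poly_mapping_eqI)
  fix m
  have "Poly_Mapping.keys (reduce v) \<subseteq> Poly_Mapping.keys v"
    by (auto simp: in_keys_iff)
  then have "lin_ext vscale (\<lambda>l. reduce (g l)) (reduce v) =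
      (\<Sum>l\<in>Poly_Mapping.keys v. vscale (Poly_Mapping.lookup (reduce v) l) (reduce (g l)))"
    by (rule free.lin_ext_superset[OF finite_keys])
  then show "Poly_Mapping.lookup (reduce (lin_ext vscale g v)) m =
      Poly_Mapping.lookup (lin_ext vscale (\<lambda>l. reduce (g l)) (reduce v)) m"
    by (simp add: lookup_lin_ext lookup_sum const_coeff_sum)
qed

lemma tensor_diff_reduce: "tensor_diff d i (reduce v) = reduce (lin_ext vscale (d i) v)"
  by (simp add: tensor_diff_def reduce_lin_ext)

text \<open>An entry of a degree-preserving matrix that survives reduction has degree 0, so it joins
  basis vectors of equal degree.\<close>

lemma reduced_map_in_tensor_comp:
  assumes f: "\<And>l. l < r i \<Longrightarrow> f l \<in> free_comp (r' j) (a' j) (a i l)"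
    and v: "v \<in> tensor_comp r a i e"
  shows "lin_ext vscale (\<lambda>l. reduce (f l)) v \<in> tensor_comp r' a' j e"
proof -
  have *: "m < r' j \<and> a' j m = e"
    if "Poly_Mapping.lookup (lin_ext vscale (\<lambda>l. reduce (f l)) v) m \<noteq> 0" for m
  proof -
    have "\<exists>l\<in>Poly_Mapping.keys v. Poly_Mapping.lookup v l * Poly_Mapping.lookup (reduce (f l)) m \<noteq> 0"
      using that unfolding lookup_lin_ext by (rule contrapos_np) (intro sum.neutral, simp)
    then obtain l where l: "l \<in> Poly_Mapping.keys v" "const_coeff (Poly_Mapping.lookup (f l) m) \<noteq> 0"
      by auto
    have "l < r i" "a i l = e" using v l(1) by (auto simp: tensor_comp_def free_mod_def)
    then have fl: "f l \<in> free_comp (r' j) (a' j) e" using f by blast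
    have "m \<in> Poly_Mapping.keys (f l)" using l(2) by (auto simp: in_keys_iff)
    then have "m < r' j" using fl by (auto simp: free_comp_def free_mod_def)
    moreover from this have "homogeneous (e - a' j m) (Poly_Mapping.lookup (f l) m)"
      using fl by (auto simp: free_comp_def)
    ultimately show ?thesis using const_coeff_homogeneous(1) l(2) by fastforce
  qed
  show ?thesis
    unfolding tensor_comp_def free_mod_def
    using * by (auto simp: in_keys_iff)
qed

lemma tensor_comp_subset_span:
  "(tensor_comp r a i e :: (nat \<Rightarrow>\<^sub>0 'k::field) set) \<subseteq> free.span ((\<lambda>l. Poly_Mapping.single l 1) ` {l. l < r i \<and> a i l = e})"
proof
  fix v :: "nat \<Rightarrow>\<^sub>0 'k" assume v: "v \<in> tensor_comp r a i e"
  have "lin_ext vscale (\<lambda>l. Poly_Mapping.single l 1) v \<in>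
      free.span ((\<lambda>l. Poly_Mapping.single l 1) ` {l. l < r i \<and> a i l = e})"
    using v by (intro free.lin_ext_in_subspace[OF free.subspace_span] free.span_base imageI)
      (auto simp: tensor_comp_def free_mod_def)
  then show "v \<in> free.span ((\<lambda>l. Poly_Mapping.single l 1) ` {l. l < r i \<and> a i l = e})"
    by (simp add: lin_ext_single_one)
qed

section \<open>Comparison of resolutions\<close>

context graded_free_resolution
begin

abbreviation im :: "nat \<Rightarrow> (nat \<Rightarrow>\<^sub>0 ('k, 'n) mpoly) set" where
  "im i \<equiv> lin_ext vscale (d i) ` free_mod (r (Suc i))"

lemma diff_in_im: "l < r (Suc i) \<Longrightarrow> d i l \<in> im i"
  by (rule image_eqI[of _ _ "Poly_Mapping.single l 1"]) (auto simp: free_mod_def)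

lemma im_subset_free_mod: "im i \<subseteq> free_mod (r i)"
  by (auto simp: free_mod_def intro!: free.lin_ext_in_subspace[OF subspace_free_mod, unfolded free_mod_def]
      free_comp_in_free_mod[OF diff_degree, unfolded free_mod_def])

lemma im_0_iff: "v \<in> im 0 \<longleftrightarrow> v \<in> free_mod (r 0) \<and> lin_ext scale \<epsilon> v = 0"
  using exact_0 by auto

lemma im_Suc_iff: "v \<in> im (Suc i) \<longleftrightarrow> v \<in> free_mod (r (Suc i)) \<and> lin_ext vscale (d i) v = 0"
  using exact_Suc[of i] by auto

lemma ex_homogeneous_lift:
  assumes "\<And>l. l < k \<Longrightarrow> w l \<in> free_comp (r i) (a i) (b l)" "\<And>l. l < k \<Longrightarrow> w l \<in> im i"
  shows "\<exists>h. \<forall>l<k. h l \<in> free_comp (r (Suc i)) (a (Suc i)) (b l) \<and> lin_ext vscale (d i) (h l) = w l"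
proof -
  have "\<exists>v. l < k \<longrightarrow> v \<in> free_comp (r (Suc i)) (a (Suc i)) (b l) \<and> lin_ext vscale (d i) v = w l" for l
  proof (cases "l < k")
    case True
    obtain v where "v \<in> free_comp (r (Suc i)) (a (Suc i)) (b l)" "lin_ext vscale (d i) v = w l"
      using free_gr.homogeneous_preimage[OF diff_degree[of _ i] assms(1)[OF True] assms(2)[OF True]] .
    then show ?thesis by blast
  qed simp
  then have "\<forall>l. \<exists>v. l < k \<longrightarrow> v \<in> free_comp (r (Suc i)) (a (Suc i)) (b l) \<and> lin_ext vscale (d i) v = w l"
    by (rule allI)
  from choice[OF this] show ?thesis by blast
qed

lemma lin_ext_in_free_mod:
  "(\<And>l. l < k \<Longrightarrow> f l \<in> free_comp r' a' (b l)) \<Longrightarrow> v \<in> free_mod k \<Longrightarrow> lin_ext vscale f v \<in> free_mod r'"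
  by (rule free.lin_ext_in_subspace[OF subspace_free_mod])
    (auto simp: free_mod_def free_comp_def)

end

text \<open>The identity of the module is lifted level by level, on basis vectors, through the exact
  target complex.\<close>

lemma ex_comparison_map:
  fixes scale :: "('k::field, 'n::finite) mpoly \<Rightarrow> 'm::ab_group_add \<Rightarrow> 'm"
  assumes "graded_free_resolution scale gr r a \<epsilon> d" "graded_free_resolution scale gr r' a' \<epsilon>' d'"
  shows "\<exists>f. (\<forall>i l. l < r i \<longrightarrow> f i l \<in> free_comp (r' i) (a' i) (a i l)) \<and>
    (\<forall>l<r 0. lin_ext scale \<epsilon>' (f 0 l) = \<epsilon> l) \<and>
    (\<forall>i l. l < r (Suc i) \<longrightarrow> lin_ext vscale (d' i) (f (Suc i) l) = lin_ext vscale (f i) (d i l))"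
proof -
  interpret F: graded_free_resolution scale gr r a \<epsilon> d by fact
  interpret G: graded_free_resolution scale gr r' a' \<epsilon>' d' by fact
  have "\<exists>v. l < r 0 \<longrightarrow> v \<in> free_comp (r' 0) (a' 0) (a 0 l) \<and> lin_ext scale \<epsilon>' v = \<epsilon> l" for l
  proof (cases "l < r 0")
    case True
    have "\<epsilon> l \<in> lin_ext scale \<epsilon>' ` free_mod (r' 0)" using G.aug_surj by simp
    from F.homogeneous_preimage[OF G.aug_degree F.aug_degree[OF True] this]
    obtain v where "v \<in> free_comp (r' 0) (a' 0) (a 0 l)" "lin_ext scale \<epsilon>' v = \<epsilon> l" .
    then show ?thesis by blast
  qed simp
  then have "\<forall>l. \<exists>v. l < r 0 \<longrightarrow> v \<in> free_comp (r' 0) (a' 0) (a 0 l) \<and> lin_ext scale \<epsilon>' v = \<epsilon> l"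
    by (rule allI)
  from choice[OF this] obtain f0 where
    f0: "\<And>l. l < r 0 \<Longrightarrow> f0 l \<in> free_comp (r' 0) (a' 0) (a 0 l)"
      "\<And>l. l < r 0 \<Longrightarrow> lin_ext scale \<epsilon>' (f0 l) = \<epsilon> l" by blast
  \<comment> \<open>The second clause puts the images of the columns \<open>d i l\<close> where the
    next lift needs them. At level 0 it follows from compatibility with the augmentations.\<close>
  define P where "P i f \<longleftrightarrow> (\<forall>l<r i. f l \<in> free_comp (r' i) (a' i) (a i l)) \<and>
    (\<forall>v\<in>F.im i. lin_ext vscale f v \<in> G.im i)" for i f
  define Q where "Q i f g \<longleftrightarrow> (\<forall>l<r (Suc i). lin_ext vscale (d' i) (g l) = lin_ext vscale f (d i l))" for i f g
  have P0: "P 0 f0"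
    unfolding P_def
  proof (intro conjI ballI)
    show "\<forall>l<r 0. f0 l \<in> free_comp (r' 0) (a' 0) (a 0 l)" using f0(1) by blast
    fix v assume "v \<in> F.im 0"
    then have v: "v \<in> free_mod (r 0)" "lin_ext scale \<epsilon> v = 0" by (simp_all only: F.im_0_iff)
    have "lin_ext scale \<epsilon>' (lin_ext vscale f0 v) = lin_ext scale \<epsilon> v"
      unfolding F.lin_ext_comp[symmetric] by (rule F.lin_ext_cong_free_mod[OF v(1) f0(2)])
    with v show "lin_ext vscale f0 v \<in> G.im 0"
      unfolding G.im_0_iff by (simp add: F.lin_ext_in_free_mod[OF f0(1)])
  qed
  have step: "\<exists>g. P (Suc i) g \<and> Q i f g" if "P i f" for i f
  proof -
    have f: "\<And>l. l < r i \<Longrightarrow> f l \<in> free_comp (r' i) (a' i) (a i l)"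
      "\<And>v. v \<in> F.im i \<Longrightarrow> lin_ext vscale f v \<in> G.im i"
      using that unfolding P_def by blast+
    have "\<exists>g. \<forall>l<r (Suc i). g l \<in> free_comp (r' (Suc i)) (a' (Suc i)) (a (Suc i) l) \<and>
        lin_ext vscale (d' i) (g l) = lin_ext vscale f (d i l)"
      by (rule G.ex_homogeneous_lift)
        (simp_all add: free_gr.lin_ext_in_gr[OF f(1) F.diff_degree] f(2)[OF F.diff_in_im])
    then obtain g where
      g: "\<And>l. l < r (Suc i) \<Longrightarrow> g l \<in> free_comp (r' (Suc i)) (a' (Suc i)) (a (Suc i) l)"
        "\<And>l. l < r (Suc i) \<Longrightarrow> lin_ext vscale (d' i) (g l) = lin_ext vscale f (d i l)"
      by blast
    have "lin_ext vscale g v \<in> G.im (Suc i)" if "v \<in> F.im (Suc i)" for v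
    proof -
      have v: "v \<in> free_mod (r (Suc i))" "lin_ext vscale (d i) v = 0"
        using that by (simp_all only: F.im_Suc_iff)
      have "lin_ext vscale (d' i) (lin_ext vscale g v) = lin_ext vscale (\<lambda>l. lin_ext vscale f (d i l)) v"
        unfolding free.lin_ext_comp[of "d' i" g, symmetric]
        by (rule free.lin_ext_cong_free_mod[OF v(1) g(2)])
      also have "\<dots> = 0" by (simp add: free.lin_ext_comp v(2))
      finally show ?thesis
        unfolding G.im_Suc_iff by (simp add: F.lin_ext_in_free_mod[OF g(1) v(1)])
    qed
    with g show ?thesis unfolding P_def Q_def by blast
  qed
  obtain f where f: "f 0 = f0" "\<And>i. P i (f i)" "\<And>i. Q i (f i) (f (Suc i))"
    using dependent_sequence[of P f0 Q, OF P0 step] by metis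
  show ?thesis
    using f(2,3) f0(2) unfolding f(1)[symmetric] P_def Q_def by (intro exI[of _ f]) simp
qed

text \<open>A chain map over the zero map of the module has the form \<open>d' h + h d\<close>. On a
  cycle of \<open>F \<otimes> K\<close> the summand \<open>h d\<close> dies under reduction, and the
  other one is a boundary.\<close>

lemma nullhomotopic_tor:
  fixes scale :: "('k::field, 'n::finite) mpoly \<Rightarrow> 'm::ab_group_add \<Rightarrow> 'm"
    and f :: "nat \<Rightarrow> nat \<Rightarrow> (nat \<Rightarrow>\<^sub>0 ('k, 'n) mpoly)"
  assumes F: "graded_free_resolution scale gr r a \<epsilon> d"
    and G: "graded_free_resolution scale gr r' a' \<epsilon>' d'"
    and f: "\<And>i l. l < r i \<Longrightarrow> f i l \<in> free_comp (r' i) (a' i) (a i l)"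
      "\<And>l. l < r 0 \<Longrightarrow> lin_ext scale \<epsilon>' (f 0 l) = 0"
      "\<And>i l. l < r (Suc i) \<Longrightarrow> lin_ext vscale (d' i) (f (Suc i) l) = lin_ext vscale (f i) (d i l)"
    and v: "v \<in> tor_cycles r a d i e"
  shows "lin_ext vscale (\<lambda>l. reduce (f i l)) v \<in> tor_boundaries r' a' d' i e"
proof -
  interpret F: graded_free_resolution scale gr r a \<epsilon> d by fact
  interpret G: graded_free_resolution scale gr r' a' \<epsilon>' d' by fact
  \<comment> \<open>On \<open>im i\<close> the summand \<open>h d\<close> of the homotopy vanishes
    because \<open>d d = 0\<close>, so the identity reads \<open>d' h = f\<close> there. In this
    form it covers level 0 as well and makes \<open>f - h d\<close> a cycle at the next
    level.\<close>
  define P where "P i h \<longleftrightarrow> (\<forall>l<r i. h l \<in> free_comp (r' (Suc i)) (a' (Suc i)) (a i l)) \<and>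
    (\<forall>v\<in>F.im i. lin_ext vscale (d' i) (lin_ext vscale h v) = lin_ext vscale (f i) v)" for i h
  define Q where "Q i h h' \<longleftrightarrow>
    (\<forall>l<r (Suc i). lin_ext vscale (d' (Suc i)) (h' l) = f (Suc i) l - lin_ext vscale h (d i l))" for i h h'
  have f_im: "f 0 l \<in> G.im 0" if "l < r 0" for l
    unfolding G.im_0_iff using f(2)[OF that] free_comp_in_free_mod[OF f(1)[OF that]] by simp
  have "\<exists>h. \<forall>l<r 0. h l \<in> free_comp (r' (Suc 0)) (a' (Suc 0)) (a 0 l) \<and> lin_ext vscale (d' 0) (h l) = f 0 l"
    by (rule G.ex_homogeneous_lift) (simp_all add: f(1) f_im)
  then obtain h0 where
    h0: "\<And>l. l < r 0 \<Longrightarrow> h0 l \<in> free_comp (r' (Suc 0)) (a' (Suc 0)) (a 0 l)"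
      "\<And>l. l < r 0 \<Longrightarrow> lin_ext vscale (d' 0) (h0 l) = f 0 l" by blast
  have h0_lin: "lin_ext vscale (d' 0) (lin_ext vscale h0 v) = lin_ext vscale (f 0) v"
    if "v \<in> free_mod (r 0)" for v
    unfolding free.lin_ext_comp[of "d' 0" h0, symmetric] by (rule free.lin_ext_cong_free_mod[OF that h0(2)])
  have P0: "P 0 h0"
    using h0(1) h0_lin F.im_subset_free_mod[of 0] unfolding P_def by blast
  have step: "\<exists>h'. P (Suc i) h' \<and> Q i h h'" if "P i h" for i h
  proof -
    have h: "\<And>l. l < r i \<Longrightarrow> h l \<in> free_comp (r' (Suc i)) (a' (Suc i)) (a i l)"
      "\<And>v. v \<in> F.im i \<Longrightarrow> lin_ext vscale (d' i) (lin_ext vscale h v) = lin_ext vscale (f i) v"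
      using that unfolding P_def by blast+
    let ?w = "\<lambda>l. f (Suc i) l - lin_ext vscale h (d i l)"
    have w: "?w l \<in> free_comp (r' (Suc i)) (a' (Suc i)) (a (Suc i) l)" if "l < r (Suc i)" for l
      by (rule free_gr.gr_diff[OF f(1)[OF that] free_gr.lin_ext_in_gr[OF h(1) F.diff_degree[OF that]]])
    have w_im: "?w l \<in> G.im (Suc i)" if "l < r (Suc i)" for l
      unfolding G.im_Suc_iff using that free_comp_in_free_mod[OF w[OF that]]
      by (simp add: f(3) h(2)[OF F.diff_in_im])
    have "\<exists>h'. \<forall>l<r (Suc i). h' l \<in> free_comp (r' (Suc (Suc i))) (a' (Suc (Suc i))) (a (Suc i) l) \<and>
        lin_ext vscale (d' (Suc i)) (h' l) = ?w l"
      by (rule G.ex_homogeneous_lift) (simp_all only: w w_im)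
    then obtain h' where
      h': "\<And>l. l < r (Suc i) \<Longrightarrow> h' l \<in> free_comp (r' (Suc (Suc i))) (a' (Suc (Suc i))) (a (Suc i) l)"
        "\<And>l. l < r (Suc i) \<Longrightarrow> lin_ext vscale (d' (Suc i)) (h' l) = ?w l"
      by blast
    have "lin_ext vscale (d' (Suc i)) (lin_ext vscale h' v) = lin_ext vscale (f (Suc i)) v"
      if "v \<in> F.im (Suc i)" for v
    proof -
      have v: "v \<in> free_mod (r (Suc i))" "lin_ext vscale (d i) v = 0"
        using that by (simp_all only: F.im_Suc_iff)
      have "lin_ext vscale (d' (Suc i)) (lin_ext vscale h' v) = lin_ext vscale ?w v"
        unfolding free.lin_ext_comp[of "d' (Suc i)" h', symmetric]
        by (rule free.lin_ext_cong_free_mod[OF v(1) h'(2)])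
      also have "\<dots> = lin_ext vscale (f (Suc i)) v"
        by (simp add: free.lin_ext_minus_fun free.lin_ext_comp v(2))
      finally show ?thesis .
    qed
    with h' show ?thesis unfolding P_def Q_def by blast
  qed
  obtain h where h: "h 0 = h0" "\<And>i. P i (h i)" "\<And>i. Q i (h i) (h (Suc i))"
    using dependent_sequence[of P h0 Q, OF P0 step] by metis
  have h_deg: "h i l \<in> free_comp (r' (Suc i)) (a' (Suc i)) (a i l)" if "l < r i" for i l
    using h(2) that unfolding P_def by blast
  have v_comp: "v \<in> tensor_comp r a i e" using v by (simp add: tor_cycles_def)
  then have v_free: "v \<in> free_mod (r i)" by (simp add: tensor_comp_def)
  let ?v = "const_vec v :: nat \<Rightarrow>\<^sub>0 ('k, 'n) mpoly"
  have v_mod: "?v \<in> free_mod (r i)" using v_free by simp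
  have hv: "reduce (lin_ext vscale (h i) ?v) \<in> tensor_comp r' a' (Suc i) e"
    unfolding reduce_lin_ext reduce_const_vec
    by (rule reduced_map_in_tensor_comp[where r = r and r' = r', OF _ v_comp]) (rule h_deg)
  have "reduce (lin_ext vscale (f i) ?v) = tensor_diff d' i (reduce (lin_ext vscale (h i) ?v))"
  proof (cases i)
    case 0
    then show ?thesis using h0_lin[of ?v] v_mod by (simp add: tensor_diff_reduce h(1))
  next
    case (Suc k)
    have vk: "?v \<in> free_mod (r (Suc k))" using v_mod Suc by simp
    have hQ: "lin_ext vscale (d' (Suc k)) (h (Suc k) l) = f (Suc k) l - lin_ext vscale (h k) (d k l)"
      if "l < r (Suc k)" for l using h(3)[of k] that unfolding Q_def by blast
    have "lin_ext vscale (d' (Suc k)) (lin_ext vscale (h (Suc k)) ?v) =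
        lin_ext vscale (\<lambda>l. f (Suc k) l - lin_ext vscale (h k) (d k l)) ?v"
      unfolding free.lin_ext_comp[of "d' (Suc k)" "h (Suc k)", symmetric]
      by (rule free.lin_ext_cong_free_mod[OF vk hQ])
    also have "\<dots> = lin_ext vscale (f (Suc k)) ?v - lin_ext vscale (h k) (lin_ext vscale (d k) ?v)"
      by (simp add: free.lin_ext_minus_fun free.lin_ext_comp)
    finally have eq: "lin_ext vscale (f (Suc k)) ?v =
        lin_ext vscale (d' (Suc k)) (lin_ext vscale (h (Suc k)) ?v) +
        lin_ext vscale (h k) (lin_ext vscale (d k) ?v)" by simp
    \<comment> \<open>The constant lift of a Tor cycle need not be a cycle of \<open>F\<close>. Its
      image under \<open>d k\<close> vanishes only modulo the variables, and \<open>h k\<close>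
      preserves this.\<close>
    have "tensor_diff d k (reduce ?v) = 0"
      using v unfolding Suc tor_cycles_def by simp
    then have "reduce (lin_ext vscale (d k) ?v) = 0" by (simp only: tensor_diff_reduce)
    then have "reduce (lin_ext vscale (h k) (lin_ext vscale (d k) ?v)) = 0"
      unfolding reduce_lin_ext[of "h k"] by simp
    then show ?thesis unfolding Suc eq reduce_add tensor_diff_reduce by simp
  qed
  then have "reduce (lin_ext vscale (f i) ?v) \<in> tor_boundaries r' a' d' i e"
    using hv unfolding tor_boundaries_def by simp
  then show ?thesis unfolding reduce_lin_ext reduce_const_vec .
qed

section \<open>Linear algebra over the base field\<close>

interpretation lin_ext_hom: module_hom "vscale :: 'k::field \<Rightarrow> _" vscale "lin_ext vscale g" for g
  by (intro module_hom.intro module_hom_axioms.intro module_vscale) simp_all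

text \<open>Applying the linear map removes \<open>b\<close> from any dependency and leaves one
  among the images of \<open>X\<close>. Later \<open>b\<close> spans the boundaries and
  \<open>X\<close> represents a basis of homology.\<close>

lemma independent_Un_preimages:
  assumes "free.independent b" "\<And>x. x \<in> b \<Longrightarrow> lin_ext vscale g x = (0 :: nat \<Rightarrow>\<^sub>0 'k::field)"
    and "finite X" "inj_on (lin_ext vscale g) X" "free.independent (lin_ext vscale g ` X)"
  shows "free.independent (b \<union> X) \<and> b \<inter> X = {}"
  using assms(3-)
proof (induction X)
  case empty
  with assms(1) show ?case by simp
next
  case (insert x X)
  have "free.independent (lin_ext vscale g ` X)"
    using insert.prems(2) by (rule free.independent_mono) auto
  then have IH: "free.independent (b \<union> X)" "b \<inter> X = {}"
    using insert.IH insert.prems(1) by (auto intro: inj_on_subset)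
  have "lin_ext vscale g ` insert x X - {lin_ext vscale g x} = lin_ext vscale g ` X"
    using insert.prems(1) insert.hyps(2) by auto
  then have not_span: "lin_ext vscale g x \<notin> free.span (lin_ext vscale g ` X)"
    using insert.prems(2) unfolding kvec.dependent_def by (metis image_eqI insertI1)
  have "x \<notin> free.span (b \<union> X)"
  proof
    assume "x \<in> free.span (b \<union> X)"
    then have "lin_ext vscale g x \<in> free.span (lin_ext vscale g ` (b \<union> X))"
      unfolding lin_ext_hom.span_image by (rule imageI)
    also have "free.span (lin_ext vscale g ` (b \<union> X)) \<subseteq> free.span (lin_ext vscale g ` X)"
    proof (rule free.span_minimal)
      show "lin_ext vscale g ` (b \<union> X) \<subseteq> free.span (lin_ext vscale g ` X)"
        using assms(2) by (auto simp: free.span_zero intro: free.span_base)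
    qed (rule free.subspace_span)
    finally show False using not_span by blast
  qed
  then have "free.independent (insert x (b \<union> X))" "x \<notin> b"
    using kvec.independent_insertI[OF _ IH(1)] free.span_base[of x "b \<union> X"] by blast+
  with IH(2) show ?case by auto
qed

lemma independent_singles: "free.independent ((\<lambda>l. Poly_Mapping.single l (1 :: 'k::field)) ` A)"
proof -
  have "x \<notin> free.span ((\<lambda>l. Poly_Mapping.single l (1 :: 'k)) ` A - {x})"
    if x: "x \<in> (\<lambda>l. Poly_Mapping.single l (1 :: 'k)) ` A" for x
  proof
    obtain l where l: "x = Poly_Mapping.single l 1" using x by auto
    have sub: "free.subspace {v :: nat \<Rightarrow>\<^sub>0 'k. Poly_Mapping.lookup v l = 0}"
      by (simp add: free.subspace_def lookup_add)
    assume "x \<in> free.span ((\<lambda>l. Poly_Mapping.single l (1 :: 'k)) ` A - {x})"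
    also have "\<dots> \<subseteq> {v. Poly_Mapping.lookup v l = 0}"
      by (rule free.span_minimal[OF _ sub]) (auto simp: l lookup_single when_def)
    finally show False by (simp add: l)
  qed
  then show ?thesis unfolding kvec.dependent_def by blast
qed

lemma inj_single_one: "inj_on (\<lambda>l. Poly_Mapping.single l (1 :: 'k::field)) A"
  by (rule inj_onI) (metis lookup_single_eq lookup_single_not_eq zero_neq_one)

section \<open>Tor read off a minimal resolution\<close>

context minimal_graded_resolution
begin

lemma reduce_diff_zero: "l < r (Suc i) \<Longrightarrow> reduce (d i l) = 0"
  by (rule poly_mapping_eqI) (simp add: minimal)

lemma tensor_diff_zero: "v \<in> free_mod (r (Suc i)) \<Longrightarrow> tensor_diff d i v = 0"
  unfolding tensor_diff_def lin_ext_def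
  by (rule sum.neutral) (auto simp: reduce_diff_zero free_mod_def)

lemma tor_cycles_eq: "tor_cycles r a d i e = tensor_comp r a i e"
  by (cases i) (auto simp: tor_cycles_def tensor_comp_def tensor_diff_zero)

lemma tor_boundaries_subset: "tor_boundaries r a d i e \<subseteq> {0}"
  by (auto simp: tor_boundaries_def tensor_comp_def tensor_diff_zero)

end

text \<open>The difference of \<open>g f\<close> and the identity lifts the zero map of the module,
  so it is null-homotopic. Neither resolution has to be minimal, which allows use with both orders
  of composition.\<close>

lemma comparison_maps_inverse:
  fixes scale :: "('k::field, 'n::finite) mpoly \<Rightarrow> 'm::ab_group_add \<Rightarrow> 'm"
    and f g :: "nat \<Rightarrow> nat \<Rightarrow> (nat \<Rightarrow>\<^sub>0 ('k, 'n) mpoly)"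
  assumes F: "graded_free_resolution scale gr r a \<epsilon> d"
    and f: "\<And>i l. l < r i \<Longrightarrow> f i l \<in> free_comp (r' i) (a' i) (a i l)"
      "\<And>l. l < r 0 \<Longrightarrow> lin_ext scale \<epsilon>' (f 0 l) = \<epsilon> l"
      "\<And>i l. l < r (Suc i) \<Longrightarrow> lin_ext vscale (d' i) (f (Suc i) l) = lin_ext vscale (f i) (d i l)"
    and g: "\<And>i l. l < r' i \<Longrightarrow> g i l \<in> free_comp (r i) (a i) (a' i l)"
      "\<And>l. l < r' 0 \<Longrightarrow> lin_ext scale \<epsilon> (g 0 l) = \<epsilon>' l"
      "\<And>i l. l < r' (Suc i) \<Longrightarrow> lin_ext vscale (d i) (g (Suc i) l) = lin_ext vscale (g i) (d' i l)"
    and v: "v \<in> tor_cycles r a d i e"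
  shows "lin_ext vscale (\<lambda>l. reduce (g i l)) (lin_ext vscale (\<lambda>l. reduce (f i l)) v) - v \<in>
    tor_boundaries r a d i e"
proof -
  interpret F: graded_free_resolution scale gr r a \<epsilon> d by fact
  let ?h = "\<lambda>i l. lin_ext vscale (g i) (f i l) - Poly_Mapping.single l 1"
  have "lin_ext vscale (\<lambda>l. reduce (?h i l)) v \<in> tor_boundaries r a d i e"
  proof (rule nullhomotopic_tor[OF F F _ _ _ v])
    show "?h i l \<in> free_comp (r i) (a i) (a i l)" if "l < r i" for i l
    proof (rule free_gr.gr_diff)
      show "lin_ext vscale (g i) (f i l) \<in> free_comp (r i) (a i) (a i l)"
        by (rule free_gr.lin_ext_in_gr[OF g(1)[of _ i] f(1)[OF that]])
      show "Poly_Mapping.single l 1 \<in> free_comp (r i) (a i) (a i l)"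
        using that by (auto simp: free_comp_def free_mod_def lookup_single when_def)
    qed
    show "lin_ext scale \<epsilon> (?h 0 l) = 0" if "l < r 0" for l
    proof -
      have "lin_ext scale \<epsilon> (lin_ext vscale (g 0) (f 0 l)) = lin_ext scale \<epsilon>' (f 0 l)"
        unfolding F.lin_ext_comp[symmetric]
        by (rule F.lin_ext_cong_free_mod[OF free_comp_in_free_mod[OF f(1)[OF that]] g(2)])
      then show ?thesis by (simp add: f(2)[OF that])
    qed
    show "lin_ext vscale (d i) (?h (Suc i) l) = lin_ext vscale (?h i) (d i l)" if "l < r (Suc i)" for i l
    proof -
      have "lin_ext vscale (d i) (lin_ext vscale (g (Suc i)) (f (Suc i) l)) =
          lin_ext vscale (\<lambda>l. lin_ext vscale (g i) (d' i l)) (f (Suc i) l)"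
        unfolding free.lin_ext_comp[of "d i", symmetric]
        by (rule free.lin_ext_cong_free_mod[OF free_comp_in_free_mod[OF f(1)[OF that]] g(3)])
      also have "\<dots> = lin_ext vscale (g i) (lin_ext vscale (f i) (d i l))"
        unfolding free.lin_ext_comp by (simp add: f(3)[OF that])
      finally show ?thesis
        by (simp add: free.lin_ext_minus_fun free.lin_ext_comp lin_ext_single_one)
    qed
  qed
  then show ?thesis
    by (simp add: reduce_diff reduce_lin_ext free.lin_ext_minus_fun free.lin_ext_comp
        lin_ext_single_one)
qed

text \<open>In the minimal complex all boundaries vanish, so \<open>f g\<close> is the identity
  there, whereas \<open>g f\<close> is so only modulo boundaries. Hence the cycles of the other
  complex are the direct sum of its boundaries and the span of the \<open>g\<close>-image of the
  standard basis \<open>E\<close>.\<close>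

lemma tor_dim_eq_minimal:
  fixes scale :: "('k::field, 'n::finite) mpoly \<Rightarrow> 'm::ab_group_add \<Rightarrow> 'm"
  assumes F: "graded_free_resolution scale gr r a \<epsilon> d"
    and G: "minimal_graded_resolution scale gr r' a' \<epsilon>' d'"
  shows "tor_dim r a d i e = card {l. l < r' i \<and> a' i l = e}"
proof -
  interpret F: graded_free_resolution scale gr r a \<epsilon> d by fact
  interpret G: minimal_graded_resolution scale gr r' a' \<epsilon>' d' by fact
  have G': "graded_free_resolution scale gr r' a' \<epsilon>' d'" by unfold_locales
  obtain f where f: "\<And>i l. l < r i \<Longrightarrow> f i l \<in> free_comp (r' i) (a' i) (a i l)"
    "\<And>l. l < r 0 \<Longrightarrow> lin_ext scale \<epsilon>' (f 0 l) = \<epsilon> l"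
    "\<And>i l. l < r (Suc i) \<Longrightarrow> lin_ext vscale (d' i) (f (Suc i) l) = lin_ext vscale (f i) (d i l)"
    using ex_comparison_map[OF F G'] by metis
  obtain g where g: "\<And>i l. l < r' i \<Longrightarrow> g i l \<in> free_comp (r i) (a i) (a' i l)"
    "\<And>l. l < r' 0 \<Longrightarrow> lin_ext scale \<epsilon> (g 0 l) = \<epsilon>' l"
    "\<And>i l. l < r' (Suc i) \<Longrightarrow> lin_ext vscale (d i) (g (Suc i) l) = lin_ext vscale (g i) (d' i l)"
    using ex_comparison_map[OF G' F] by metis
  let ?f = "\<lambda>i. lin_ext vscale (\<lambda>l. reduce (f i l))" and ?g = "\<lambda>i. lin_ext vscale (\<lambda>l. reduce (g i l))"
  have gf: "?g i (?f i v) - v \<in> tor_boundaries r a d i e" if "v \<in> tor_cycles r a d i e" for v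
    using comparison_maps_inverse[OF F f g(1,2) _ that] g(3) by blast
  have fg: "?f i (?g i w) = w" if "w \<in> tensor_comp r' a' i e" for w
  proof -
    have w: "w \<in> tor_cycles r' a' d' i e" using that by (simp add: G.tor_cycles_eq)
    have "?f i (?g i w) - w \<in> tor_boundaries r' a' d' i e"
      using comparison_maps_inverse[OF G' g f(1,2) _ w] f(3) by blast
    then have "?f i (?g i w) - w = 0" using G.tor_boundaries_subset by blast
    then show ?thesis by simp
  qed
  have f_comp: "?f i v \<in> tensor_comp r' a' i e" if "v \<in> tensor_comp r a i e" for v i
    by (rule reduced_map_in_tensor_comp[where r = r and r' = r', OF _ that]) (rule f(1))
  have f_boundary: "?f i v = 0" if v: "v \<in> tor_boundaries r a d i e" for v
  proof -
    obtain u where u: "u \<in> tensor_comp r a (Suc i) e" "v = tensor_diff d i u"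
      using v unfolding tor_boundaries_def by auto
    let ?u = "const_vec u :: nat \<Rightarrow>\<^sub>0 ('k, 'n) mpoly"
    have u': "?u \<in> free_mod (r (Suc i))" using u(1) by (simp add: tensor_comp_def)
    have "?f i v = reduce (lin_ext vscale (f i) (lin_ext vscale (d i) ?u))"
      unfolding u(2) reduce_lin_ext tensor_diff_def reduce_const_vec ..
    also have "lin_ext vscale (f i) (lin_ext vscale (d i) ?u) =
        lin_ext vscale (d' i) (lin_ext vscale (f (Suc i)) ?u)"
      unfolding free.lin_ext_comp[symmetric]
      by (rule free.lin_ext_cong_free_mod[OF u' f(3)[symmetric]])
    also have "reduce \<dots> = tensor_diff d' i (?f (Suc i) u)"
      unfolding reduce_lin_ext tensor_diff_def reduce_const_vec ..
    also have "\<dots> = 0"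
      using f_comp[OF u(1)] by (intro G.tensor_diff_zero) (simp add: tensor_comp_def)
    finally show ?thesis .
  qed
  have g_cycle: "?g i w \<in> tor_cycles r a d i e" if w: "w \<in> tensor_comp r' a' i e" for w
  proof -
    have "?g i w \<in> tensor_comp r a i e"
      by (rule reduced_map_in_tensor_comp[where r = r' and r' = r, OF _ w]) (rule g(1))
    moreover have "tensor_diff d k (?g (Suc k) w) = 0" if i: "i = Suc k" for k
    proof -
      let ?w = "const_vec w :: nat \<Rightarrow>\<^sub>0 ('k, 'n) mpoly"
      have w': "w \<in> free_mod (r' (Suc k))" using w by (simp add: tensor_comp_def i)
      then have w'': "?w \<in> free_mod (r' (Suc k))" by simp
      have "tensor_diff d k (?g (Suc k) w) = reduce (lin_ext vscale (d k) (lin_ext vscale (g (Suc k)) ?w))"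
        unfolding reduce_lin_ext tensor_diff_def reduce_const_vec ..
      also have "lin_ext vscale (d k) (lin_ext vscale (g (Suc k)) ?w) =
          lin_ext vscale (g k) (lin_ext vscale (d' k) ?w)"
        unfolding free.lin_ext_comp[symmetric]
        by (rule free.lin_ext_cong_free_mod[OF w'' g(3)])
      also have "reduce \<dots> = ?g k (tensor_diff d' k w)"
        unfolding reduce_lin_ext tensor_diff_def reduce_const_vec ..
      also have "\<dots> = 0" by (simp add: G.tensor_diff_zero[OF w'])
      finally show ?thesis .
    qed
    ultimately show ?thesis by (cases i) (simp_all add: tor_cycles_def)
  qed
  let ?Z = "tor_cycles r a d i e" and ?B = "tor_boundaries r a d i e"
  define E where "E = (\<lambda>l. Poly_Mapping.single l (1 :: 'k)) ` {l. l < r' i \<and> a' i l = e}"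
  have E_fin: "finite E" by (simp add: E_def)
  have card_E: "card E = card {l. l < r' i \<and> a' i l = e}"
    unfolding E_def by (rule card_image[OF inj_single_one])
  have E_comp: "E \<subseteq> tensor_comp r' a' i e"
    by (auto simp: E_def tensor_comp_def free_mod_def)
  have B_Z: "?B \<subseteq> ?Z"
  proof
    fix v assume v: "v \<in> ?B"
    then obtain u where u: "u \<in> tensor_comp r a (Suc i) e" "v = tensor_diff d i u"
      unfolding tor_boundaries_def by auto
    have "v \<in> tensor_comp r a i e"
      unfolding u(2) tensor_diff_def
      by (rule reduced_map_in_tensor_comp[where r = r and r' = r, OF _ u(1)]) (rule F.diff_degree)
    moreover have "tensor_diff d k (tensor_diff d (Suc k) u) = 0" if i: "i = Suc k" for k
    proof -
      let ?u = "const_vec u :: nat \<Rightarrow>\<^sub>0 ('k, 'n) mpoly"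
      have "lin_ext vscale (d (Suc k)) ?u \<in> F.im (Suc k)"
        using u(1) by (intro imageI) (simp add: tensor_comp_def i)
      then have "lin_ext vscale (d k) (lin_ext vscale (d (Suc k)) ?u) = 0"
        unfolding F.im_Suc_iff by simp
      then have "reduce (lin_ext vscale (d k) (lin_ext vscale (d (Suc k)) ?u)) = 0" by simp
      then show ?thesis
        unfolding reduce_lin_ext tensor_diff_def reduce_const_vec .
    qed
    ultimately show "v \<in> ?Z" by (cases i) (simp_all add: tor_cycles_def u(2))
  qed
  obtain b where b: "b \<subseteq> ?B" "free.independent b" "?B \<subseteq> free.span b" "card b = kvec.dim ?B"
    using kvec.basis_exists[of ?B] by blast
  \<comment> \<open>Finiteness of \<open>b\<close> lets the cardinalities add up, since
    \<open>card\<close> is 0 on infinite sets.\<close>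
  have "b \<subseteq> free.span ((\<lambda>l. Poly_Mapping.single l 1) ` {l. l < r i \<and> a i l = e})"
    using b(1) B_Z tensor_comp_subset_span[of r a i e] unfolding tor_cycles_def by blast
  from kvec.independent_span_bound[OF _ b(2) this] have b_fin: "finite b" by simp
  have fg': "?f i (?g i w) = w" if "w \<in> E" for w using that fg E_comp by blast
  have fgE: "?f i ` ?g i ` E = E"
    unfolding image_image by (simp add: fg')
  have inj: "inj_on (?f i) (?g i ` E)"
    by (rule inj_onI) (auto simp: fg')
  have injg: "inj_on (?g i) E"
    by (rule inj_on_inverseI) (rule fg')
  have ind: "free.independent (b \<union> ?g i ` E) \<and> b \<inter> ?g i ` E = {}"
  proof (rule independent_Un_preimages[OF b(2) _ _ inj])
    show "?f i x = 0" if "x \<in> b" for x using that b(1) f_boundary by blast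
    show "finite (?g i ` E)" using E_fin by simp
    show "free.independent (?f i ` ?g i ` E)"
      unfolding fgE unfolding E_def by (rule independent_singles)
  qed
  have sub: "b \<union> ?g i ` E \<subseteq> ?Z"
    using b(1) B_Z E_comp g_cycle by blast
  have span: "?Z \<subseteq> free.span (b \<union> ?g i ` E)"
  proof
    fix v assume v: "v \<in> ?Z"
    then have "?f i v \<in> tensor_comp r' a' i e" by (intro f_comp) (simp add: tor_cycles_def)
    then have "?f i v \<in> free.span E" using tensor_comp_subset_span unfolding E_def by blast
    then have "?g i (?f i v) \<in> free.span (?g i ` E)"
      unfolding lin_ext_hom.span_image by (rule imageI)
    then have 1: "?g i (?f i v) \<in> free.span (b \<union> ?g i ` E)"
      using free.span_mono[of "?g i ` E" "b \<union> ?g i ` E"] by blast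
    have 2: "?g i (?f i v) - v \<in> free.span (b \<union> ?g i ` E)"
      using gf[OF v] b(3) free.span_mono[of b "b \<union> ?g i ` E"] by blast
    from free.span_diff[OF 1 2] show "v \<in> free.span (b \<union> ?g i ` E)" by simp
  qed
  have "kvec.dim ?Z = card (b \<union> ?g i ` E)"
    using kvec.basis_card_eq_dim[OF sub span] ind by simp
  also have "\<dots> = card b + card (?g i ` E)"
    using ind b_fin E_fin by (intro card_Un_disjoint) auto
  also have "card (?g i ` E) = card E" by (rule card_image[OF injg])
  finally show ?thesis unfolding tor_dim_def by (simp add: b(4) card_E)
qed

text \<open>The resolution inside \<open>betti\<close> is an unspecified choice; comparison with a
  minimal one makes the choice harmless.\<close>

lemma betti_eq_minimal:
  assumes "minimal_graded_resolution scale gr r a \<epsilon> d"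
  shows "betti scale gr i e = card {l. l < r i \<and> a i l = e}"
proof -
  interpret minimal_graded_resolution scale gr r a \<epsilon> d by fact
  define F where "F = (SOME (r, a, \<epsilon>, d). graded_free_resolution scale gr r a \<epsilon> d)"
  obtain r' a' \<epsilon>' d' where F: "F = (r', a', \<epsilon>', d')" by (cases F)
  have "case (r, a, \<epsilon>, d) of (r, a, \<epsilon>, d) \<Rightarrow> graded_free_resolution scale gr r a \<epsilon> d"
    by simp unfold_locales
  then have "case F of (r, a, \<epsilon>, d) \<Rightarrow> graded_free_resolution scale gr r a \<epsilon> d"
    unfolding F_def by (rule someI)
  then have "graded_free_resolution scale gr r' a' \<epsilon>' d'" by (simp add: F)
  from tor_dim_eq_minimal[OF this assms] show ?thesis
    unfolding betti_def F_def[symmetric] by (simp add: F)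
qed

section \<open>Faces of a cycle\<close>

text \<open>Induction on \<open>q\<close>, splitting the faces by a vertex \<open>v\<close> of some
  \<open>B\<close>. Those containing \<open>v\<close> come from the link of \<open>v\<close>, which
  inherits the exchange property; exchanging \<open>v\<close> for some \<open>x\<close> yields a
  member avoiding \<open>v\<close>, all of whose subsets avoid it too. Pascal's rule adds the two
  bounds.\<close>

lemma card_faces_ge_choose:
  fixes \<B> :: "'n::finite set set"
  assumes "\<B> \<noteq> {}" "\<And>B. B \<in> \<B> \<Longrightarrow> card B = q" "k \<le> q"
    and "\<And>B b. B \<in> \<B> \<Longrightarrow> b \<in> B \<Longrightarrow> \<exists>x. x \<notin> B \<and> insert x (B - {b}) \<in> \<B>"
  shows "Suc q choose k \<le> card {D. card D = k \<and> (\<exists>B\<in>\<B>. D \<subseteq> B)}"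
  using assms
proof (induction q arbitrary: \<B> k)
  case 0
  then have "{} \<in> {D. card D = k \<and> (\<exists>B\<in>\<B>. D \<subseteq> B)}" by (simp add: ex_in_conv)
  then have "card {D. card D = k \<and> (\<exists>B\<in>\<B>. D \<subseteq> B)} > 0" unfolding card_gt_0_iff by (blast intro: finite)
  with 0(3) show ?case by simp
next
  case (Suc q)
  show ?case
  proof (cases k)
    case 0
    with Suc.prems(1) have "{} \<in> {D. card D = k \<and> (\<exists>B\<in>\<B>. D \<subseteq> B)}" by (simp add: ex_in_conv)
    then have "card {D. card D = k \<and> (\<exists>B\<in>\<B>. D \<subseteq> B)} > 0" unfolding card_gt_0_iff by (blast intro: finite)
    with 0 show ?thesis by simp
  next
    case (Suc j)
    obtain B where B: "B \<in> \<B>" using Suc.prems(1) by blast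
    then have "B \<noteq> {}" using Suc.prems(2)[of B] by auto
    then obtain v where v: "v \<in> B" by blast
    define link where "link = (\<lambda>B. B - {v}) ` {B \<in> \<B>. v \<in> B}"
    have "Suc q choose j \<le> card {D. card D = j \<and> (\<exists>B\<in>link. D \<subseteq> B)}"
    proof (rule Suc.IH)
      show "link \<noteq> {}" unfolding link_def using B v by blast
      show "card B' = q" if "B' \<in> link" for B'
      proof -
        obtain B1 where B1: "B1 \<in> \<B>" "v \<in> B1" "B' = B1 - {v}"
          using \<open>B' \<in> link\<close> unfolding link_def by blast
        then show ?thesis using Suc.prems(2)[OF B1(1)] by simp
      qed
      show "j \<le> q" using Suc.prems(3) Suc by simp
      show "\<exists>x. x \<notin> B' \<and> insert x (B' - {b}) \<in> link" if "B' \<in> link" "b \<in> B'" for B' b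
      proof -
        obtain B1 where B1: "B1 \<in> \<B>" "v \<in> B1" "B' = B1 - {v}" using \<open>B' \<in> link\<close> unfolding link_def by blast
        with \<open>b \<in> B'\<close> have b: "b \<in> B1" "b \<noteq> v" by auto
        from Suc.prems(4)[OF B1(1) b(1)] obtain x where x: "x \<notin> B1" "insert x (B1 - {b}) \<in> \<B>" by blast
        \<comment> \<open>Since \<open>v\<close> is in \<open>B1\<close> and \<open>x\<close> is
          not, the new vertex differs from \<open>v\<close>, and the exchange takes place within the
          link.\<close>
        have "insert x (B' - {b}) = insert x (B1 - {b}) - {v}" using x B1 by auto
        moreover have "v \<in> insert x (B1 - {b})" using B1(2) b(2) by simp
        ultimately have "insert x (B' - {b}) \<in> link" unfolding link_def using x(2) by blast
        then show ?thesis using x(1) B1(3) by blast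
      qed
    qed
    also have "\<dots> = card (insert v ` {D. card D = j \<and> (\<exists>B\<in>link. D \<subseteq> B)})"
    proof (rule card_image[symmetric], rule inj_onI)
      fix D D' assume "D \<in> {D. card D = j \<and> (\<exists>B\<in>link. D \<subseteq> B)}"
        "D' \<in> {D. card D = j \<and> (\<exists>B\<in>link. D \<subseteq> B)}" and eq: "insert v D = insert v D'"
      then have "v \<notin> D" "v \<notin> D'" unfolding link_def by blast+
      with eq show "D = D'" by (simp add: insert_ident)
    qed
    finally have star: "Suc q choose j \<le> card (insert v ` {D. card D = j \<and> (\<exists>B\<in>link. D \<subseteq> B)})" .
    obtain x where x: "x \<notin> B" "insert x (B - {v}) \<in> \<B>" using Suc.prems(4)[OF B v] by blast
    let ?B = "insert x (B - {v})"
    have "card {D. D \<subseteq> ?B \<and> card D = Suc j} = Suc q choose Suc j"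
      using n_subsets[of ?B "Suc j"] Suc.prems(2)[OF x(2)] by simp
    then have "Suc (Suc q) choose Suc j \<le>
        card (insert v ` {D. card D = j \<and> (\<exists>B\<in>link. D \<subseteq> B)}) + card {D. D \<subseteq> ?B \<and> card D = Suc j}"
      using star by simp
    also have "\<dots> = card (insert v ` {D. card D = j \<and> (\<exists>B\<in>link. D \<subseteq> B)} \<union> {D. D \<subseteq> ?B \<and> card D = Suc j})"
    proof (rule card_Un_disjoint[symmetric])
      show "insert v ` {D. card D = j \<and> (\<exists>B\<in>link. D \<subseteq> B)} \<inter> {D. D \<subseteq> ?B \<and> card D = Suc j} = {}"
        using x v by blast
    qed simp_all
    also have "\<dots> \<le> card {D. card D = k \<and> (\<exists>B\<in>\<B>. D \<subseteq> B)}"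
    proof (rule card_mono, simp, rule Un_least)
      show "insert v ` {D. card D = j \<and> (\<exists>B\<in>link. D \<subseteq> B)} \<subseteq> {D. card D = k \<and> (\<exists>B\<in>\<B>. D \<subseteq> B)}"
      proof (rule image_subsetI)
        fix D assume "D \<in> {D. card D = j \<and> (\<exists>B\<in>link. D \<subseteq> B)}"
        then obtain B1 where "card D = j" "B1 \<in> \<B>" "v \<in> B1" "D \<subseteq> B1 - {v}"
          unfolding link_def by blast
        then have "card (insert v D) = k" "insert v D \<subseteq> B1"
          using Suc by (auto simp: card_insert_if subset_Diff_insert)
        with \<open>B1 \<in> \<B>\<close> show "insert v D \<in> {D. card D = k \<and> (\<exists>B\<in>\<B>. D \<subseteq> B)}" by blast
      qed
      show "{D. D \<subseteq> ?B \<and> card D = Suc j} \<subseteq> {D. card D = k \<and> (\<exists>B\<in>\<B>. D \<subseteq> B)}"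
        using x(2) Suc by blast
    qed
    finally show ?thesis using Suc by simp
  qed
qed

section \<open>Alternating functions of lists\<close>

text \<open>In characteristic 2, \<open>swap\<close> says nothing about repeated letters, hence the
  separate \<open>repeat\<close>. Only lists of length \<open>q\<close> are constrained.\<close>

locale alternating =
  fixes \<gamma> :: "'x list \<Rightarrow> 'v::ab_group_add" and q :: nat
  assumes swap: "length (us @ x # y # vs) = q \<Longrightarrow> \<gamma> (us @ x # y # vs) = - \<gamma> (us @ y # x # vs)"
    and repeat: "length (us @ x # x # vs) = q \<Longrightarrow> \<gamma> (us @ x # x # vs) = 0"
begin

lemma move:
  "length (us @ as @ x # bs) = q \<Longrightarrow>
    \<gamma> (us @ as @ x # bs) = \<gamma> (us @ x # as @ bs) \<or> \<gamma> (us @ as @ x # bs) = - \<gamma> (us @ x # as @ bs)"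
proof (induction as arbitrary: bs rule: rev_induct)
  case (snoc y as)
  have "\<gamma> (us @ (as @ [y]) @ x # bs) = - \<gamma> (us @ as @ x # y # bs)"
    using swap[of "us @ as" y x bs] snoc.prems by simp
  with snoc.IH[of "y # bs"] snoc.prems show ?case by auto
qed simp

text \<open>The fixed prefix \<open>us\<close> carries the induction: the head of \<open>xs\<close>
  is moved to the front of \<open>ys\<close> and then joins the prefix.\<close>

lemma permute:
  "length (us @ xs) = q \<Longrightarrow> mset xs = mset ys \<Longrightarrow>
    \<gamma> (us @ ys) = \<gamma> (us @ xs) \<or> \<gamma> (us @ ys) = - \<gamma> (us @ xs)"
proof (induction xs arbitrary: us ys)
  case (Cons x xs)
  from Cons.prems(2) have "x \<in> set ys" by (metis list.set_intros(1) set_mset_mset)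
  then obtain as bs where ys: "ys = as @ x # bs" by (metis split_list)
  with Cons.prems(2) have m: "mset xs = mset (as @ bs)" by simp
  then have "length xs = length (as @ bs)" by (rule mset_eq_length)
  then have "\<gamma> (us @ ys) = \<gamma> (us @ x # as @ bs) \<or> \<gamma> (us @ ys) = - \<gamma> (us @ x # as @ bs)"
    using move[of us as x bs] Cons.prems(1) by (simp add: ys)
  moreover have "\<gamma> (us @ x # as @ bs) = \<gamma> (us @ x # xs) \<or> \<gamma> (us @ x # as @ bs) = - \<gamma> (us @ x # xs)"
    using Cons.IH[of "us @ [x]" "as @ bs"] Cons.prems(1) m by simp
  ultimately show ?case by auto
qed simp

lemma same_set:
  assumes "distinct xs" "distinct ys" "set xs = set ys" "length xs = q"
  shows "\<gamma> ys = \<gamma> xs \<or> \<gamma> ys = - \<gamma> xs"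
  using permute[of "[]" xs ys] assms by (simp add: set_eq_iff_mset_eq_distinct)

lemma not_distinct:
  assumes "\<not> distinct xs" "length xs = q"
  shows "\<gamma> xs = 0"
proof -
  obtain us x as bs where xs: "xs = us @ [x] @ as @ [x] @ bs"
    using not_distinct_decomp[OF assms(1)] by blast
  have "\<gamma> (us @ x # x # as @ bs) = 0"
    using repeat[of us x "as @ bs"] assms(2) by (simp add: xs)
  with move[of "us @ [x]" as x bs] show ?thesis using assms(2) by (auto simp: xs)
qed

end

section \<open>Leading multidegrees of alternating cycles\<close>

definition exponent_of :: "'n list \<Rightarrow> ('n::finite \<Rightarrow>\<^sub>0 nat)" where
  "exponent_of xs = sum_list (map (\<lambda>x. Poly_Mapping.single x 1) xs)"

lemma exponent_of_simps [simp]: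
  "exponent_of [] = 0"
  "exponent_of (x # xs) = Poly_Mapping.single x 1 + exponent_of xs"
  "exponent_of (xs @ ys) = exponent_of xs + exponent_of ys"
  by (simp_all add: exponent_of_def)

lemma lookup_exponent_of: "Poly_Mapping.lookup (exponent_of xs) x = count_list xs x"
  by (induction xs) (auto simp: lookup_add lookup_single when_def)

lemma exponent_of_eq_imp_set_eq: "exponent_of xs = exponent_of ys \<Longrightarrow> set xs = set ys"
  by (rule set_eqI) (metis count_list_0_iff lookup_exponent_of)

lemma exponent_of_cong_set:
  assumes "distinct xs" "distinct ys" "set xs = set ys"
  shows "exponent_of xs = exponent_of ys"
proof -
  have "mset xs = mset ys" using assms by (simp add: set_eq_iff_mset_eq_distinct)
  then show ?thesis
    unfolding exponent_of_def sum_mset_sum_list[symmetric] mset_map by simp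
qed

text \<open>Multigraded by \<open>w + exponent_of xs\<close>, the cycle condition is homogeneous, so the terms of
  \<open>\<gamma>\<close> of a single multidegree form a simplicial cycle times a monomial. For the largest
  multidegree \<open>u\<close>, the function \<open>\<lambda>C. \<gamma> (D @ C)\<close> has leading multidegree \<open>u - exponent_of D\<close>
  whenever \<open>D\<close> is a face of that cycle.\<close>

lemma alternating_cycle_independent_faces:
  fixes \<gamma> :: "'n::finite list \<Rightarrow> ('n \<Rightarrow>\<^sub>0 nat) \<Rightarrow>\<^sub>0 'k::field"
  assumes "alternating \<gamma> q"
    and cycle: "\<forall>xs. Suc (length xs) = q \<longrightarrow>
      (\<Sum>x\<in>UNIV. Poly_Mapping.single (Poly_Mapping.single x 1) 1 * \<gamma> (xs @ [x])) = 0"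
    and nonzero: "length xs0 = q" "\<gamma> xs0 \<noteq> 0"
    and k: "k \<le> q"
  shows "\<exists>\<D>. finite \<D> \<and> (\<forall>D\<in>\<D>. length D = k) \<and> Suc q choose k \<le> card \<D> \<and>
    (\<forall>c :: 'n list \<Rightarrow> 'k.
       (\<forall>C. length C = q - k \<longrightarrow> (\<Sum>D\<in>\<D>. Poly_Mapping.single 0 (c D) * \<gamma> (D @ C)) = 0) \<longrightarrow>
       (\<forall>D\<in>\<D>. c D = 0))"
proof -
  interpret alternating \<gamma> q by fact
  let ?l = Poly_Mapping.lookup
  let ?X = "\<lambda>x. Poly_Mapping.single x 1 :: 'n \<Rightarrow>\<^sub>0 nat"
  \<comment> \<open>All terms of all values of \<open>\<gamma>\<close>: finitely many, so a largest
    multidegree exists.\<close>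
  define \<Omega> where "\<Omega> = (SIGMA xs:{xs. length xs = q}. Poly_Mapping.keys (\<gamma> xs))"
  have "finite {xs :: 'n list. length xs = q}" using finite_lists_length_eq[of "UNIV :: 'n set" q] by simp
  then have fin: "finite \<Omega>" unfolding \<Omega>_def by (intro finite_SigmaI) simp_all
  have mem: "(xs, w) \<in> \<Omega> \<longleftrightarrow> length xs = q \<and> ?l (\<gamma> xs) w \<noteq> 0" for xs w
    by (simp add: \<Omega>_def in_keys_iff)
  let ?deg = "\<lambda>(xs, w). lex_key (w + exponent_of xs)"
  obtain w0 where "?l (\<gamma> xs0) w0 \<noteq> 0" using nonzero(2) by (metis poly_mapping_eqI lookup_zero)
  then have "(xs0, w0) \<in> \<Omega>" using nonzero(1) by (simp add: mem)
  then have "\<Omega> \<noteq> {}" by blast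
  with fin have "Max (?deg ` \<Omega>) \<in> ?deg ` \<Omega>" by (intro Max_in) simp_all
  then obtain m where m: "Max (?deg ` \<Omega>) = ?deg m" "m \<in> \<Omega>" by (rule imageE)
  obtain xs1 w1 where "m = (xs1, w1)" by (cases m)
  with m have top: "(xs1, w1) \<in> \<Omega>" "?deg (xs1, w1) = Max (?deg ` \<Omega>)" by simp_all
  define u where "u = w1 + exponent_of xs1"
  have max: "lex_key (w + exponent_of xs) \<le> lex_key u" if "(xs, w) \<in> \<Omega>" for xs w
  proof -
    have "?deg (xs, w) \<le> Max (?deg ` \<Omega>)" using that fin by (intro Max_ge finite_imageI imageI)
    with top(2) show ?thesis by (simp add: u_def)
  qed
  have distinct: "distinct xs" if "(xs, w) \<in> \<Omega>" for xs w
    using not_distinct that by (metis mem lookup_zero)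
  have coeff_set: "?l (\<gamma> ys) w \<noteq> 0"
    if "(xs, w) \<in> \<Omega>" "distinct ys" "set ys = set xs" for xs ys w
    using same_set[OF distinct[OF that(1)] that(2)] that by (auto simp: mem)
  \<comment> \<open>The facets of the simplicial cycle found in multidegree
    \<open>u\<close>.\<close>
  define \<B> where "\<B> = {B. \<exists>xs w. (xs, w) \<in> \<Omega> \<and> set xs = B \<and> w + exponent_of xs = u}"
  have \<B>_ne: "\<B> \<noteq> {}" using top(1) by (auto simp: \<B>_def u_def)
  have \<B>_card: "card B = q" if "B \<in> \<B>" for B
    using that distinct by (auto simp: \<B>_def mem distinct_card)
  have \<B>_exchange: "\<exists>x. x \<notin> B \<and> insert x (B - {b}) \<in> \<B>" if B: "B \<in> \<B>" "b \<in> B" for B b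
  proof -
    obtain xs w where xs: "(xs, w) \<in> \<Omega>" "set xs = B" "w + exponent_of xs = u"
      using B(1) by (auto simp: \<B>_def)
    define zs where "zs = remove1 b xs"
    have dist: "distinct xs" using distinct[OF xs(1)] .
    have zs: "distinct zs" "set zs = B - {b}" "Suc (length zs) = q"
      using dist B(2) xs(1,2) by (auto simp: zs_def length_remove1 mem set_remove1_eq) (metis Suc_pred length_pos_if_in_set)
    have zsb: "distinct (zs @ [b])" "set (zs @ [b]) = set xs" using zs B(2) xs(2) by auto
    \<comment> \<open>At this monomial the summand for \<open>b\<close> of the cycle condition
      contributes the nonzero coefficient of \<open>\<gamma> (zs @ [b])\<close> at \<open>w\<close>.
      Another letter must cancel it, and its term has multidegree \<open>u\<close> again.\<close>
    let ?w = "w + ?X b"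
    have lookup_term: "?l (Poly_Mapping.single (?X x) 1 * p) v = (if ?l v x = 0 then 0 else ?l p (v - ?X x))"
      for x v and p :: "('n \<Rightarrow>\<^sub>0 nat) \<Rightarrow>\<^sub>0 'k"
    proof (cases "?l v x = 0")
      case True
      have "v \<noteq> ?X x + v'" for v'
      proof
        assume "v = ?X x + v'"
        then have "?l v x = 1 + ?l v' x" by (simp add: lookup_add)
        with True show False by simp
      qed
      with True show ?thesis by (simp add: lookup_single_mult_eq_0)
    next
      case False
      then have "v = ?X x + (v - ?X x)"
        by (intro poly_mapping_eqI) (auto simp: lookup_add lookup_minus lookup_single when_def)
      with False show ?thesis using lookup_single_mult[of "?X x" 1 p "v - ?X x"] by simp
    qed
    have "0 = (\<Sum>x\<in>UNIV. ?l (Poly_Mapping.single (?X x) 1 * \<gamma> (zs @ [x])) ?w)"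
      using arg_cong[OF cycle[rule_format, OF zs(3)], of "\<lambda>p. ?l p ?w"] by (simp add: lookup_sum)
    also have "\<dots> = ?l (Poly_Mapping.single (?X b) 1 * \<gamma> (zs @ [b])) ?w +
        (\<Sum>x\<in>UNIV - {b}. ?l (Poly_Mapping.single (?X x) 1 * \<gamma> (zs @ [x])) ?w)"
      by (rule sum.remove) simp_all
    also have "?l (Poly_Mapping.single (?X b) 1 * \<gamma> (zs @ [b])) ?w = ?l (\<gamma> (zs @ [b])) w"
      unfolding add.commute[of w] by simp
    finally have "(\<Sum>x\<in>UNIV - {b}. ?l (Poly_Mapping.single (?X x) 1 * \<gamma> (zs @ [x])) ?w) \<noteq> 0"
      using coeff_set[OF xs(1) zsb] by auto
    then obtain x where "x \<in> UNIV - {b}" "?l (Poly_Mapping.single (?X x) 1 * \<gamma> (zs @ [x])) ?w \<noteq> 0"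
      by (rule sum.not_neutral_contains_not_neutral)
    then have x: "x \<noteq> b" "?l (Poly_Mapping.single (?X x) 1 * \<gamma> (zs @ [x])) ?w \<noteq> 0" by simp_all
    then have x': "?l ?w x \<noteq> 0" "?l (\<gamma> (zs @ [x])) (?w - ?X x) \<noteq> 0"
      unfolding lookup_term by (auto split: if_splits)
    have mem_x: "(zs @ [x], ?w - ?X x) \<in> \<Omega>" using x'(2) zs(3) by (simp add: mem)
    from distinct[OF this] have "x \<notin> B - {b}" using zs(2) by auto
    moreover have "(?w - ?X x) + ?X x = ?w"
      using x'(1) by (intro poly_mapping_eqI) (auto simp: lookup_add lookup_minus lookup_single when_def)
    then have "(?w - ?X x) + exponent_of (zs @ [x]) = w + exponent_of (zs @ [b])"
      by (simp add: ac_simps)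
    then have "(?w - ?X x) + exponent_of (zs @ [x]) = u"
      using exponent_of_cong_set[OF zsb(1) dist zsb(2)] xs(3) by simp
    then have "insert x (B - {b}) \<in> \<B>"
      unfolding \<B>_def using mem_x zs(2) by (intro CollectI exI[of _ "zs @ [x]"] exI[of _ "?w - ?X x"]) simp
    ultimately show ?thesis using x(1) by blast
  qed
  define \<F> where "\<F> = {D. card D = k \<and> (\<exists>B\<in>\<B>. D \<subseteq> B)}"
  have card_\<F>: "Suc q choose k \<le> card \<F>"
    unfolding \<F>_def using \<B>_ne \<B>_card k \<B>_exchange by (rule card_faces_ge_choose)
  have "\<forall>D :: 'n set. \<exists>xs. set xs = D \<and> distinct xs" by (simp add: finite_distinct_list)
  from choice[OF this] obtain list_of :: "'n set \<Rightarrow> 'n list"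
    where list_of: "set (list_of D) = D" "distinct (list_of D)" for D by blast
  have len: "length (list_of D) = card D" for D using list_of distinct_card by metis
  have inj: "inj_on list_of \<F>" by (rule inj_on_inverseI[of _ set]) (rule list_of)
  define \<D> where "\<D> = list_of ` \<F>"
  have fin_\<D>: "finite \<D>" by (simp add: \<D>_def)
  have "c D = 0"
    if c: "\<And>C. length C = q - k \<Longrightarrow> (\<Sum>D\<in>\<D>. Poly_Mapping.single 0 (c D) * \<gamma> (D @ C)) = 0" and "D \<in> \<D>"
    for c :: "'n list \<Rightarrow> 'k" and D
  proof (rule ccontr)
    assume "c D \<noteq> 0"
    define S where "S = {D \<in> \<D>. c D \<noteq> 0}"
    let ?key = "\<lambda>D. lex_key (exponent_of D)"
    have S: "finite S" "S \<noteq> {}" using fin_\<D> \<open>c D \<noteq> 0\<close> \<open>D \<in> \<D>\<close> by (auto simp: S_def)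
    \<comment> \<open>The smallest exponent of \<open>D\<close> belongs to the largest leading
      multidegree \<open>u - exponent_of D\<close>, which no other summand reaches.\<close>
    then have "Min (?key ` S) \<in> ?key ` S" by simp
    then obtain D0 where D0: "D0 \<in> S" "?key D0 = Min (?key ` S)" by auto
    have min: "?key D0 \<le> ?key D" if "D \<in> S" for D using S(1) that D0(2) by simp
    obtain F0 where F0: "F0 \<in> \<F>" "D0 = list_of F0" using D0(1) by (auto simp: S_def \<D>_def)
    then obtain B where B: "B \<in> \<B>" "F0 \<subseteq> B" "card F0 = k" by (auto simp: \<F>_def)
    then obtain xs w where xs: "(xs, w) \<in> \<Omega>" "set xs = B" "w + exponent_of xs = u"
      by (auto simp: \<B>_def)
    \<comment> \<open>Completing \<open>D0\<close> to the facet \<open>B\<close> exposes a nonzero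
      coefficient at \<open>w\<close>. Any other summand with a term there would have
      \<open>exponent_of D\<close> at most that of \<open>D0\<close>, by maximality of
      \<open>u\<close>.\<close>
    define C where "C = list_of (B - F0)"
    have C: "length C = q - k"
      using B \<B>_card by (simp add: C_def len card_Diff_subset)
    have D0C: "distinct (D0 @ C)" "set (D0 @ C) = set xs"
      using F0(2) B(2) xs(2) by (auto simp: list_of C_def)
    have coeff: "?l (\<gamma> (D0 @ C)) w \<noteq> 0" by (rule coeff_set[OF xs(1) D0C])
    have u: "w + exponent_of (D0 @ C) = u"
      using exponent_of_cong_set[OF D0C(1) distinct[OF xs(1)] D0C(2)] xs(3) by simp
    have others: "c D * ?l (\<gamma> (D @ C)) w = 0" if D: "D \<in> \<D> - {D0}" for D
    proof (rule ccontr)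
      assume nz: "c D * ?l (\<gamma> (D @ C)) w \<noteq> 0"
      then have "D \<in> S" using D by (auto simp: S_def)
      have "length D = k" using D by (auto simp: \<D>_def len \<F>_def)
      then have "(D @ C, w) \<in> \<Omega>" using nz C k by (simp add: mem)
      from max[OF this] have "lex_key w + ?key C + ?key D \<le> lex_key w + ?key C + ?key D0"
        unfolding u[symmetric] by (simp only: exponent_of_simps lex_key_add ac_simps)
      then have "?key D \<le> ?key D0" by (rule add_le_imp_le_left)
      with min[OF \<open>D \<in> S\<close>] have "exponent_of D = exponent_of D0" by simp
      then have "set D = set D0" by (rule exponent_of_eq_imp_set_eq)
      moreover obtain F where "D = list_of F" using D by (auto simp: \<D>_def)
      ultimately have "D = D0" using F0(2) by (simp add: list_of)
      with D show False by simp
    qed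
    have lookup_const: "?l (Poly_Mapping.single 0 a * p) w = a * ?l p w" for a and p :: "('n \<Rightarrow>\<^sub>0 nat) \<Rightarrow>\<^sub>0 'k"
      using lookup_single_mult[of 0 a p w] by simp
    have "0 = (\<Sum>D\<in>\<D>. c D * ?l (\<gamma> (D @ C)) w)"
      using arg_cong[OF c[OF C], of "\<lambda>p. ?l p w"] by (simp add: lookup_sum lookup_const)
    also have "\<dots> = c D0 * ?l (\<gamma> (D0 @ C)) w + (\<Sum>D\<in>\<D> - {D0}. c D * ?l (\<gamma> (D @ C)) w)"
      using fin_\<D> D0(1) by (intro sum.remove) (auto simp: S_def)
    also have "(\<Sum>D\<in>\<D> - {D0}. c D * ?l (\<gamma> (D @ C)) w) = 0"
      by (rule sum.neutral) (use others in blast)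
    finally show False using coeff D0(1) by (simp add: S_def)
  qed
  moreover have "card \<D> = card \<F>" unfolding \<D>_def by (rule card_image[OF inj])
  moreover have "\<forall>D\<in>\<D>. length D = k" by (auto simp: \<D>_def len \<F>_def)
  ultimately show ?thesis using fin_\<D> card_\<F> by (intro exI[of _ \<D>]) auto
qed

section \<open>The linear strand\<close>

lemma const_vec_zero [simp]: "const_vec 0 = 0"
  by (rule poly_mapping_eqI) simp

lemma const_vec_add: "const_vec (v + w) = const_vec v + const_vec w"
  by (rule poly_mapping_eqI) (simp add: lookup_add single_add)

lemma const_vec_vscale: "const_vec (vscale c v) = vscale (Poly_Mapping.single 0 c) (const_vec v)"
  by (rule poly_mapping_eqI) (simp add: mult_single)

text \<open>Independence of an indexed family includes that its members are distinct: if
  \<open>v x = v y\<close>, the scalars 1 and -1 would give a nontrivial relation.\<close>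

lemma card_le_if_scalars_zero:
  fixes v :: "'i \<Rightarrow> (nat \<Rightarrow>\<^sub>0 'k::field)"
  assumes "finite X" "finite S" "\<And>x. x \<in> X \<Longrightarrow> v x \<in> free.span S"
    and zero: "\<And>c. (\<Sum>x\<in>X. vscale (c x) (v x)) = 0 \<Longrightarrow> \<forall>x\<in>X. c x = 0"
  shows "card X \<le> card S"
proof -
  have inj: "inj_on v X"
  proof (rule inj_onI, rule ccontr)
    fix x y assume xy: "x \<in> X" "y \<in> X" "v x = v y" "x \<noteq> y"
    define c where "c z = (if z = x then 1 else if z = y then - 1 else (0 :: 'k))" for z
    have "(\<Sum>z\<in>X. vscale (c z) (v z)) = vscale (c x) (v x) + (\<Sum>z\<in>X - {x}. vscale (c z) (v z))"
      using assms(1) xy(1) by (rule sum.remove)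
    also have "(\<Sum>z\<in>X - {x}. vscale (c z) (v z)) =
        vscale (c y) (v y) + (\<Sum>z\<in>X - {x} - {y}. vscale (c z) (v z))"
      using assms(1) xy by (intro sum.remove) auto
    also have "(\<Sum>z\<in>X - {x} - {y}. vscale (c z) (v z)) = 0"
      by (rule sum.neutral) (auto simp: c_def)
    finally have "(\<Sum>z\<in>X. vscale (c z) (v z)) = 0"
      using xy(3,4) by (simp add: c_def)
    from zero[OF this] have "c x = 0" using xy(1) by blast
    then show False by (simp add: c_def)
  qed
  have "free.independent (v ` X)"
  proof (rule kvec.independent_if_scalars_zero)
    show "finite (v ` X)" using assms(1) by simp
    fix f w assume "(\<Sum>w\<in>v ` X. vscale (f w) w) = 0" "w \<in> v ` X"
    then show "f w = 0" using zero[of "\<lambda>x. f (v x)"] by (auto simp: sum.reindex[OF inj])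
  qed
  moreover have "v ` X \<subseteq> free.span S" using assms(3) by blast
  ultimately have "card (v ` X) \<le> card S"
    using kvec.independent_span_bound[OF assms(2)] by blast
  then show ?thesis by (simp add: card_image[OF inj])
qed

lemma single_plus_single_eq_iff:
  "Poly_Mapping.single x' (1::nat) + Poly_Mapping.single y' 1 = Poly_Mapping.single x 1 + Poly_Mapping.single (y::'n::finite) 1
    \<longleftrightarrow> x' = x \<and> y' = y \<or> x' = y \<and> y' = x"
  using exponent_of_eq_imp_set_eq[of "[x', y']" "[x, y]"]
  by (auto simp: doubleton_eq_iff add.commute)

text \<open>Only \<open>F\<^sub>1\<close> is bounded from below. The bound spreads to the later free
  modules, while the degrees in \<open>F\<^sub>0\<close> stay arbitrary.\<close>

locale linear_strand = minimal_graded_resolution scale gr r a \<epsilon> d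
  for scale :: "('k::field, 'n::finite) mpoly \<Rightarrow> 'm::ab_group_add \<Rightarrow> 'm"
    and gr :: "int \<Rightarrow> 'm set" and r a \<epsilon> d +
  fixes D :: int
  assumes degree_1: "l < r 1 \<Longrightarrow> 1 + D \<le> a 1 l"
begin

abbreviation X :: "'n \<Rightarrow> ('k, 'n) mpoly" where
  "X x \<equiv> Poly_Mapping.single (Poly_Mapping.single x 1) 1"

abbreviation bd :: "nat \<Rightarrow> (nat \<Rightarrow>\<^sub>0 'k) \<Rightarrow> (nat \<Rightarrow>\<^sub>0 ('k, 'n) mpoly)" where
  "bd i t \<equiv> lin_ext vscale (d i) (const_vec t)"

abbreviation strand :: "nat \<Rightarrow> (nat \<Rightarrow>\<^sub>0 'k) set" where
  "strand i \<equiv> tensor_comp r a i (int i + D)"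

text \<open>By exactness a cycle is a boundary, and by minimality boundaries reduce to 0.\<close>

lemma diff_injective:
  assumes "v \<in> free_mod (r (Suc i))" "reduce v \<noteq> 0"
  shows "lin_ext vscale (d i) v \<noteq> 0"
proof
  assume "lin_ext vscale (d i) v = 0"
  with assms(1) have "v \<in> im (Suc i)" by (simp only: im_Suc_iff)
  then obtain w where w: "v = lin_ext vscale (d (Suc i)) w" "w \<in> free_mod (r (Suc (Suc i)))"
    by (rule imageE)
  have "Poly_Mapping.keys (reduce w) \<subseteq> Poly_Mapping.keys w"
    by (auto simp: in_keys_iff)
  with w(2) have "reduce w \<in> free_mod (r (Suc (Suc i)))" by (simp add: free_mod_def)
  then have "reduce v = 0"
    unfolding w(1) tensor_diff_reduce[symmetric] by (rule tensor_diff_zero)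
  with assms(2) show False by simp
qed

lemma bd_nonzero: "t \<in> free_mod (r (Suc i)) \<Longrightarrow> t \<noteq> 0 \<Longrightarrow> bd i t \<noteq> 0"
  by (rule diff_injective) simp_all

lemma diff_coeff_degree:
  assumes l: "l < r (Suc i)" and nz: "Poly_Mapping.lookup (Poly_Mapping.lookup (d i l) m) t \<noteq> 0"
  shows "m < r i" "a i m < a (Suc i) l"
proof -
  note dl = diff_degree[OF l, unfolded free_comp_eq]
  have "m \<in> Poly_Mapping.keys (d i l)" using nz by (auto simp: in_keys_iff)
  then show "m < r i" using dl by (auto simp: free_mod_def)
  have "t \<noteq> 0" using nz minimal[OF l, of m] by (auto simp: const_coeff_def)
  then have "0 < monom_degree t" by (metis monom_degree_eq_0_iff gr0I)
  moreover have "a i m + int (monom_degree t) = a (Suc i) l" using dl nz by blast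
  ultimately show "a i m < a (Suc i) l" by linarith
qed

text \<open>A column of the differential is nonzero by \<open>diff_injective\<close>, and by
  minimality each of its terms sits at a basis vector of strictly smaller degree.\<close>

lemma degree_Suc: "l < r (Suc i) \<Longrightarrow> int (Suc i) + D \<le> a (Suc i) l"
proof (induction i arbitrary: l)
  case 0
  then show ?case using degree_1 by simp
next
  case (Suc i)
  have "Poly_Mapping.single l 1 \<in> free_mod (r (Suc (Suc i)))"
    using Suc.prems by (simp add: free_mod_def)
  from bd_nonzero[OF this] have "bd (Suc i) (Poly_Mapping.single l 1) \<noteq> 0" by simp
  then have "d (Suc i) l \<noteq> 0" by simp
  then obtain m t where "Poly_Mapping.lookup (Poly_Mapping.lookup (d (Suc i) l) m) t \<noteq> 0"
    by (metis poly_mapping_eqI2 lookup_zero)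
  from diff_coeff_degree[OF Suc.prems this] Suc.IH[of m] show ?case by simp
qed

section \<open>Contraction operators on the strand\<close>

text \<open>The operator \<open>e\<^sub>x\<close>. As for \<open>d\<close>, the index names the
  level of the target, so arguments come from level \<open>Suc i\<close>.\<close>

definition contract :: "nat \<Rightarrow> 'n \<Rightarrow> (nat \<Rightarrow>\<^sub>0 'k) \<Rightarrow> (nat \<Rightarrow>\<^sub>0 'k)" where
  "contract i x t = Poly_Mapping.map (\<lambda>q. Poly_Mapping.lookup q (Poly_Mapping.single x 1)) (bd i t)"

lemma contract_add: "contract i x (s + t) = contract i x s + contract i x t"
  by (rule poly_mapping_eqI) (simp add: contract_def lookup_add const_vec_add)

lemma contract_vscale: "contract i x (vscale c t) = vscale c (contract i x t)"
proof (rule poly_mapping_eqI)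
  fix l
  show "Poly_Mapping.lookup (contract i x (vscale c t)) l = Poly_Mapping.lookup (vscale c (contract i x t)) l"
    using lookup_single_mult[of 0 c "Poly_Mapping.lookup (bd i t) l" "Poly_Mapping.single x 1"]
    by (simp add: contract_def const_vec_vscale)
qed

text \<open>Two bounds meet: minimality forbids constant terms, and \<open>degree_Suc\<close> leaves
  room for degree 1 at most. The double successor keeps the target away from
  \<open>F\<^sub>0\<close>, where the second bound fails.\<close>

lemma bd_coeff:
  assumes t: "t \<in> strand (Suc (Suc i))"
    and nz: "Poly_Mapping.lookup (Poly_Mapping.lookup (bd (Suc i) t) l) m \<noteq> 0"
  shows "l < r (Suc i)" "a (Suc i) l = int (Suc i) + D" "\<exists>x. m = Poly_Mapping.single x 1"
proof -
  let ?e = "int (Suc (Suc i)) + D"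
  have t_mod: "t \<in> free_mod (r (Suc (Suc i)))" using t by (simp add: tensor_comp_def)
  have "const_vec t \<in> free_comp (r (Suc (Suc i))) (a (Suc (Suc i))) ?e"
    unfolding free_comp_eq
  proof (intro CollectI conjI allI impI)
    show "const_vec t \<in> free_mod (r (Suc (Suc i)))" using t_mod by simp
    fix l m assume "Poly_Mapping.lookup (Poly_Mapping.lookup (const_vec t) l) m \<noteq> 0"
    then have "Poly_Mapping.lookup t l \<noteq> 0" "m = 0"
      by (auto simp: lookup_single when_def split: if_splits)
    with t show "a (Suc (Suc i)) l + int (monom_degree m) = ?e"
      by (auto simp: tensor_comp_def in_keys_iff)
  qed
  from free_gr.lin_ext_in_gr[OF diff_degree[of _ "Suc i"] this]
  have bd_comp: "bd (Suc i) t \<in> free_comp (r (Suc i)) (a (Suc i)) ?e" .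
  have "l \<in> Poly_Mapping.keys (bd (Suc i) t)" using nz by (auto simp: in_keys_iff)
  with bd_comp show l: "l < r (Suc i)" by (auto simp: free_comp_eq free_mod_def)
  have sum: "a (Suc i) l + int (monom_degree m) = ?e" using bd_comp nz unfolding free_comp_eq by blast
  have "reduce (bd (Suc i) t) = 0"
    unfolding tensor_diff_reduce[symmetric] reduce_const_vec by (rule tensor_diff_zero[OF t_mod])
  then have "Poly_Mapping.lookup (reduce (bd (Suc i) t)) l = 0" by simp
  then have "m \<noteq> 0" using nz by (auto simp: const_coeff_def)
  then have "0 < monom_degree m" by (metis monom_degree_eq_0_iff gr0I)
  with sum degree_Suc[OF l] have "monom_degree m = Suc 0" by linarith
  then show "\<exists>x. m = Poly_Mapping.single x 1" by (rule monom_degree_eq_1D)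
  show "a (Suc i) l = int (Suc i) + D" using sum \<open>monom_degree m = Suc 0\<close> by simp
qed

lemma contract_in_strand:
  assumes "t \<in> strand (Suc (Suc i))"
  shows "contract (Suc i) x t \<in> strand (Suc i)"
proof -
  have "l < r (Suc i) \<and> a (Suc i) l = int (Suc i) + D"
    if "Poly_Mapping.lookup (contract (Suc i) x t) l \<noteq> 0" for l
    using bd_coeff(1,2)[OF assms, of l "Poly_Mapping.single x 1"] that by (simp add: contract_def)
  then show ?thesis by (auto simp: tensor_comp_def free_mod_def in_keys_iff)
qed

lemma bd_eq_sum_contract:
  assumes "t \<in> strand (Suc (Suc i))"
  shows "bd (Suc i) t = (\<Sum>x\<in>UNIV. vscale (X x) (const_vec (contract (Suc i) x t)))"
proof (rule poly_mapping_eqI2)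
  fix l m
  let ?b = "\<lambda>m. Poly_Mapping.lookup (Poly_Mapping.lookup (bd (Suc i) t) l) m"
  have "Poly_Mapping.lookup (Poly_Mapping.lookup
      (\<Sum>x\<in>UNIV. vscale (X x) (const_vec (contract (Suc i) x t))) l) m =
      (\<Sum>x\<in>UNIV. (?b (Poly_Mapping.single x 1) when Poly_Mapping.single x 1 = m))"
    by (simp add: lookup_sum mult_single contract_def lookup_single)
  also have "\<dots> = (\<Sum>x\<in>UNIV. if Poly_Mapping.single x 1 = m then ?b m else 0)"
    by (rule sum.cong) (auto simp: when_def)
  also have "\<dots> = ?b m"
  proof (cases "\<exists>y. m = Poly_Mapping.single y 1")
    case True
    then obtain y where y: "m = Poly_Mapping.single y 1" by blast
    have "Poly_Mapping.single x (1::nat) = m \<longleftrightarrow> x = y" for x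
      unfolding y by (metis lookup_single_eq lookup_single_not_eq zero_neq_one)
    then show ?thesis by simp
  next
    case False
    then have "?b m = 0" using bd_coeff(3)[OF assms, of l m] by blast
    then show ?thesis by (simp cong: if_cong)
  qed
  finally show "?b m = Poly_Mapping.lookup (Poly_Mapping.lookup
      (\<Sum>x\<in>UNIV. vscale (X x) (const_vec (contract (Suc i) x t))) l) m" by simp
qed

text \<open>This is \<open>\<partial>\<partial>t = 0\<close> with only the inner differential
  expanded. The outer one may end in \<open>F\<^sub>0\<close>, so \<open>i = 0\<close> is included
  and becomes the Koszul condition.\<close>

lemma sum_X_bd_contract:
  assumes "t \<in> strand (Suc (Suc i))"
  shows "(\<Sum>x\<in>UNIV. vscale (X x) (bd i (contract (Suc i) x t))) = 0"
proof -
  have "bd (Suc i) t \<in> im (Suc i)"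
    using assms by (intro imageI) (simp add: tensor_comp_def)
  then have "lin_ext vscale (d i) (bd (Suc i) t) = 0" unfolding im_Suc_iff by simp
  then show ?thesis
    unfolding bd_eq_sum_contract[OF assms] by (simp add: free.lin_ext_sum)
qed

text \<open>Compare coefficients of the quadratic monomials in
  \<open>\<partial>\<partial>t = 0\<close>; three successors ensure that both differentials expand
  into contractions.\<close>

lemma contract_anticommute:
  assumes t: "t \<in> strand (Suc (Suc (Suc i)))"
  shows "contract (Suc i) y (contract (Suc (Suc i)) x t) =
      - contract (Suc i) x (contract (Suc (Suc i)) y t)"
    and "contract (Suc i) x (contract (Suc (Suc i)) x t) = 0"
proof -
  let ?c = "\<lambda>x y. contract (Suc i) y (contract (Suc (Suc i)) x t)"
  have "0 = (\<Sum>x\<in>UNIV. vscale (X x) (bd (Suc i) (contract (Suc (Suc i)) x t)))"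
    using sum_X_bd_contract[OF t] by simp
  also have "\<dots> = (\<Sum>x\<in>UNIV. \<Sum>y\<in>UNIV. vscale (X x) (vscale (X y) (const_vec (?c x y))))"
    by (rule sum.cong[OF refl])
      (simp add: bd_eq_sum_contract[OF contract_in_strand[OF t]] free.scale_sum_right del: free.scale_scale)
  also have "\<dots> = (\<Sum>(x, y)\<in>UNIV. vscale (X x) (vscale (X y) (const_vec (?c x y))))"
    by (simp add: sum.cartesian_product del: free.scale_scale)
  finally have zero: "(\<Sum>(x, y)\<in>UNIV. vscale (X x) (vscale (X y) (const_vec (?c x y)))) = 0" by simp
  \<comment> \<open>For \<open>x = y\<close> the index set has a single element, so the squares
    vanish in characteristic 2 as well.\<close>
  have coeff: "(\<Sum>p\<in>{(x, y), (y, x)}. Poly_Mapping.lookup (?c (fst p) (snd p)) l) = 0" for x y l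
  proof -
    let ?m = "Poly_Mapping.single x (1::nat) + Poly_Mapping.single y 1"
    have "0 = (\<Sum>p\<in>UNIV. Poly_Mapping.lookup (Poly_Mapping.lookup
        (vscale (X (fst p)) (vscale (X (snd p)) (const_vec (?c (fst p) (snd p))))) l) ?m)"
      using arg_cong[OF zero, of "\<lambda>v. Poly_Mapping.lookup (Poly_Mapping.lookup v l) ?m"]
      by (simp add: lookup_sum case_prod_unfold del: free.scale_scale)
    also have "\<dots> = (\<Sum>p\<in>UNIV. if p \<in> {(x, y), (y, x)} then Poly_Mapping.lookup (?c (fst p) (snd p)) l else 0)"
    proof (rule sum.cong[OF refl])
      fix p :: "'n \<times> 'n"
      have "Poly_Mapping.lookup (vscale (X (fst p)) (vscale (X (snd p)) (const_vec (?c (fst p) (snd p))))) l =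
          Poly_Mapping.single (Poly_Mapping.single (fst p) 1 + Poly_Mapping.single (snd p) 1)
            (Poly_Mapping.lookup (?c (fst p) (snd p)) l)"
        by (simp add: mult_single del: free.scale_scale)
      moreover have "Poly_Mapping.single (fst p) 1 + Poly_Mapping.single (snd p) 1 = ?m \<longleftrightarrow>
          p \<in> {(x, y), (y, x)}"
        unfolding single_plus_single_eq_iff by (cases p) auto
      ultimately show "Poly_Mapping.lookup (Poly_Mapping.lookup
          (vscale (X (fst p)) (vscale (X (snd p)) (const_vec (?c (fst p) (snd p))))) l) ?m =
          (if p \<in> {(x, y), (y, x)} then Poly_Mapping.lookup (?c (fst p) (snd p)) l else 0)"
        by (simp only: lookup_single when_def)
    qed
    also have "\<dots> = (\<Sum>p\<in>{(x, y), (y, x)}. Poly_Mapping.lookup (?c (fst p) (snd p)) l)"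
      by (rule sum.mono_neutral_cong_right) auto
    finally show ?thesis by simp
  qed
  show diag: "?c x x = 0" for x
    by (rule poly_mapping_eqI) (use coeff[where x = x and y = x] in simp)
  show "?c x y = - ?c y x"
  proof (cases "x = y")
    case True
    then show ?thesis by (simp add: diag)
  next
    case False
    show ?thesis
      by (rule poly_mapping_eqI) (use coeff[where x = x and y = y] False in \<open>simp add: eq_neg_iff_add_eq_0\<close>)
  qed
qed

text \<open>\<open>k\<close> is the level finally reached, and the first letter acts first, so
  appending letters continues downwards.\<close>

primrec contracts :: "nat \<Rightarrow> 'n list \<Rightarrow> (nat \<Rightarrow>\<^sub>0 'k) \<Rightarrow> (nat \<Rightarrow>\<^sub>0 'k)" where
  "contracts k [] t = t"
| "contracts k (x # xs) t = contracts k xs (contract (k + length xs) x t)"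

lemma contracts_append:
  "contracts k (xs @ ys) t = contracts k ys (contracts (k + length ys) xs t)"
  by (induction xs arbitrary: t) (simp_all add: ac_simps)

lemma contracts_add: "contracts k xs (s + t) = contracts k xs s + contracts k xs t"
  by (induction xs arbitrary: s t) (simp_all add: contract_add)

lemma contracts_vscale: "contracts k xs (vscale c t) = vscale c (contracts k xs t)"
  by (induction xs arbitrary: t) (simp_all add: contract_vscale)

lemma contracts_in_strand:
  "t \<in> strand (Suc k + length xs) \<Longrightarrow> contracts (Suc k) xs t \<in> strand (Suc k)"
proof (induction xs arbitrary: t)
  case (Cons x xs)
  have "contract (Suc (k + length xs)) x t \<in> strand (Suc (k + length xs))"
    using Cons.prems by (intro contract_in_strand) simp
  then show ?case using Cons.IH by simp
qed simp

section \<open>The Koszul cycle in the free module of level 0\<close>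

text \<open>Fixing one coordinate \<open>l\<close> of \<open>F\<^sub>0\<close> turns the
  vector-valued cycle into one with polynomial values.\<close>

definition form :: "nat \<Rightarrow> (nat \<Rightarrow>\<^sub>0 'k) \<Rightarrow> 'n list \<Rightarrow> ('k, 'n) mpoly" where
  "form l t xs = Poly_Mapping.lookup (bd 0 (contracts 1 xs t)) l"

lemma form_add: "form l (s + t) xs = form l s xs + form l t xs"
  by (simp add: form_def contracts_add const_vec_add lookup_add)

lemma form_vscale: "form l (vscale c t) xs = Poly_Mapping.single 0 c * form l t xs"
  by (simp add: form_def contracts_vscale const_vec_vscale)

lemma form_zero: "form l 0 xs = 0"
  using form_add[of l 0 0 xs] by simp

lemma form_sum: "form l (\<Sum>x\<in>A. f x) xs = (\<Sum>x\<in>A. form l (f x) xs)"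
  by (induction A rule: infinite_finite_induct) (simp_all add: form_zero form_add)

lemma form_uminus: "form l (- t) xs = - form l t xs"
  using form_add[of l "- t" t xs] by (simp add: form_zero eq_neg_iff_add_eq_0)

lemma form_append: "form l t (xs @ ys) = form l (contracts (Suc (length ys)) xs t) ys"
  by (simp add: form_def contracts_append)

lemma alternating_form:
  assumes t: "t \<in> strand (Suc q)"
  shows "alternating (form l t) q"
proof
  fix us vs :: "'n list" and x y
  let ?s = "contracts (Suc (Suc (Suc (length vs)))) us t"
  have two: "form l t (us @ x # y # vs) =
      form l (contract (Suc (length vs)) y (contract (Suc (Suc (length vs))) x ?s)) vs" for x y
    by (simp add: form_append) (simp add: form_def)
  have s: "?s \<in> strand (Suc (Suc (Suc (length vs))))" if "length us + length vs + 2 = q"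
    using t that by (intro contracts_in_strand) (simp add: ac_simps)
  show "form l t (us @ x # y # vs) = - form l t (us @ y # x # vs)" if "length (us @ x # y # vs) = q"
    unfolding two using contract_anticommute(1)[OF s, of y x] that by (simp add: form_uminus)
  show "form l t (us @ x # x # vs) = 0" if "length (us @ x # x # vs) = q"
    unfolding two using contract_anticommute(2)[OF s, of x] that by (simp add: form_zero)
qed

text \<open>The last letter acts from \<open>T\<^sub>2\<close> to \<open>T\<^sub>1\<close>, so the
  sum is a coordinate of \<open>\<partial>\<partial>\<close> applied to an element of
  \<open>T\<^sub>2\<close>.\<close>

lemma form_cycle:
  assumes t: "t \<in> strand (Suc q)" and xs: "Suc (length xs) = q"
  shows "(\<Sum>x\<in>UNIV. X x * form l t (xs @ [x])) = 0"
proof -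
  let ?s = "contracts (Suc (Suc 0)) xs t"
  have "?s \<in> strand (Suc (Suc 0))"
    using t xs by (intro contracts_in_strand) (simp add: ac_simps)
  from arg_cong[OF sum_X_bd_contract[OF this], of "\<lambda>v. Poly_Mapping.lookup v l"]
  show ?thesis by (simp add: lookup_sum form_append) (simp add: form_def)
qed

text \<open>Since \<open>\<partial>\<close> kills no nonzero constant vector above level 0, some
  contraction survives at each level down to \<open>T\<^sub>1\<close>, and so does the final step
  into \<open>F\<^sub>0\<close>.\<close>

lemma ex_form_nonzero:
  "t \<in> strand (Suc q) \<Longrightarrow> t \<noteq> 0 \<Longrightarrow> \<exists>xs l. length xs = q \<and> form l t xs \<noteq> 0"
proof (induction q arbitrary: t)
  case 0
  then have "t \<in> free_mod (r (Suc 0))" by (simp add: tensor_comp_def)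
  from bd_nonzero[OF this 0(2)] obtain l where "Poly_Mapping.lookup (bd 0 t) l \<noteq> 0"
    by (metis poly_mapping_eqI lookup_zero)
  then show ?case by (intro exI[of _ "[]"] exI[of _ l]) (simp add: form_def)
next
  case (Suc q)
  then have "t \<in> free_mod (r (Suc (Suc q)))" by (simp add: tensor_comp_def)
  from bd_nonzero[OF this Suc.prems(2)] have "bd (Suc q) t \<noteq> 0" .
  have "\<exists>x. contract (Suc q) x t \<noteq> 0"
  proof (rule ccontr)
    assume "\<not> ?thesis"
    then have "bd (Suc q) t = 0"
      unfolding bd_eq_sum_contract[OF Suc.prems(1)] by (intro sum.neutral) simp
    with \<open>bd (Suc q) t \<noteq> 0\<close> show False by simp
  qed
  then obtain x where x: "contract (Suc q) x t \<noteq> 0" by blast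
  from Suc.IH[OF contract_in_strand[OF Suc.prems(1)] x] obtain xs l
    where "length xs = q" "form l (contract (Suc q) x t) xs \<noteq> 0" by blast
  then show ?case by (intro exI[of _ "x # xs"] exI[of _ l]) (simp add: form_def)
qed

text \<open>A list of \<open>p - i\<close> letters leads from \<open>T\<^sub>p\<close> to
  \<open>T\<^sub>i\<close>. The forms are linear in the vector, so a relation between the resulting
  elements of \<open>T\<^sub>i\<close> is also one between the forms.\<close>

theorem choose_le_card_strand:
  assumes t: "t \<in> strand p" "t \<noteq> 0" and i: "1 \<le> i" "i \<le> p"
  shows "p choose i \<le> card {l. l < r i \<and> a i l = int i + D}"
proof -
  obtain q where q: "p = Suc q" using i by (cases p) auto
  obtain xs0 l where xs0: "length xs0 = q" "form l t xs0 \<noteq> 0"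
    using ex_form_nonzero t unfolding q by blast
  have t': "t \<in> strand (Suc q)" using t(1) q by simp
  have "p - i \<le> q" using i q by simp
  have "\<forall>xs. Suc (length xs) = q \<longrightarrow> (\<Sum>x\<in>UNIV. X x * form l t (xs @ [x])) = 0"
    using form_cycle[OF t'] by blast
  from alternating_cycle_independent_faces[OF alternating_form[OF t'] this xs0 \<open>p - i \<le> q\<close>]
  obtain \<D> where \<D>: "finite \<D>" "\<forall>ys\<in>\<D>. length ys = p - i" "Suc q choose (p - i) \<le> card \<D>"
    and zero: "\<forall>c :: 'n list \<Rightarrow> 'k. (\<forall>C. length C = q - (p - i) \<longrightarrow>
        (\<Sum>ys\<in>\<D>. Poly_Mapping.single 0 (c ys) * form l t (ys @ C)) = 0) \<longrightarrow> (\<forall>ys\<in>\<D>. c ys = 0)"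
    by (elim exE conjE)
  let ?L = "{l. l < r i \<and> a i l = int i + D}"
  let ?S = "(\<lambda>l. Poly_Mapping.single l (1 :: 'k)) ` ?L"
  have "card \<D> \<le> card ?S"
  proof (rule card_le_if_scalars_zero[where v = "\<lambda>ys. contracts i ys t"])
    show "finite \<D>" by (rule \<D>(1))
    show "finite ?S" by simp
    show "contracts i ys t \<in> free.span ?S" if "ys \<in> \<D>" for ys
    proof -
      obtain j where j: "i = Suc j" using i by (cases i) auto
      have "Suc j + length ys = p" using \<D>(2) that i j by simp
      then have "contracts i ys t \<in> strand i"
        using contracts_in_strand[of t j ys] t(1) j by simp
      then show ?thesis using tensor_comp_subset_span by blast
    qed
    fix c :: "'n list \<Rightarrow> 'k"
    assume c: "(\<Sum>ys\<in>\<D>. vscale (c ys) (contracts i ys t)) = 0"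
    \<comment> \<open>Here \<open>q - (p - i) = i - 1\<close>, the number of contractions from
      \<open>T\<^sub>i\<close> to \<open>T\<^sub>1\<close>.\<close>
    have "(\<Sum>ys\<in>\<D>. Poly_Mapping.single 0 (c ys) * form l t (ys @ C)) = 0"
      if "length C = q - (p - i)" for C
    proof -
      have C: "Suc (length C) = i" using that i q by simp
      have "(\<Sum>ys\<in>\<D>. Poly_Mapping.single 0 (c ys) * form l t (ys @ C)) =
          form l (\<Sum>ys\<in>\<D>. vscale (c ys) (contracts i ys t)) C"
        by (simp add: form_append C form_sum form_vscale)
      also have "\<dots> = 0" unfolding c by (rule form_zero)
      finally show ?thesis .
    qed
    with zero show "\<forall>ys\<in>\<D>. c ys = 0" by blast
  qed
  also have "\<dots> \<le> card ?L" by (rule card_image_le) simp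
  finally have "Suc q choose (p - i) \<le> card ?L" using \<D>(3) by simp
  then show ?thesis using binomial_symmetric[OF i(2)] q by simp
qed

end

theorem theorem2p11:
  fixes scale :: "('k::field, 'n::finite) mpoly \<Rightarrow> 'm::ab_group_add \<Rightarrow> 'm"
    and gr :: "int \<Rightarrow> 'm set"
    and p :: nat
  assumes "graded_module scale gr"
    and "finitely_generated scale"
    and "p \<ge> 1"
    and "lin_betti scale gr 1 p \<noteq> 0"
  shows "\<forall>i\<in>{1..p}. lin_betti scale gr 1 i \<ge> p choose i"
proof -
  interpret graded_module scale gr by fact
  obtain r a \<epsilon> d where min: "minimal_graded_resolution scale gr r a \<epsilon> d"
    using ex_minimal_graded_resolution[OF assms(2)] by blast
  interpret minimal_graded_resolution scale gr r a \<epsilon> d by fact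
  note betti = betti_eq_minimal[OF min]
  define D where "D = lin_degree scale gr 1"
  have strand_betti: "lin_betti scale gr 1 i = card {l. l < r i \<and> a i l = int i + D}" for i
    by (simp add: lin_betti_def betti D_def)
  \<comment> \<open>No property of the regularity enters: it only contributes one more element to the minimum.\<close>
  have "1 + D \<le> a 1 l" if l: "l < r 1" for l
  proof -
    let ?J = "{j. betti scale gr 1 (int 1 + j) \<noteq> 0}"
    have J: "j \<in> ?J \<longleftrightarrow> (\<exists>l<r 1. a 1 l = 1 + j)" for j
    proof -
      have "finite {l. l < r 1 \<and> a 1 l = 1 + j}" by simp
      then show ?thesis by (auto simp: betti)
    qed
    have "?J \<subseteq> (\<lambda>l. a 1 l - 1) ` {..<r 1}" using J by force
    then have "finite ?J" by (rule finite_subset) simp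
    moreover have "a 1 l - 1 \<in> ?J" unfolding J using l by (intro exI[of _ l]) simp
    ultimately have "D \<le> a 1 l - 1"
      unfolding D_def lin_degree_def by (intro Min_le) auto
    then show ?thesis by simp
  qed
  then interpret linear_strand scale gr r a \<epsilon> d D by unfold_locales
  have "card {l. l < r p \<and> a p l = int p + D} \<noteq> 0"
    using assms(4) unfolding strand_betti .
  then obtain l where "l < r p" "a p l = int p + D" by (auto simp: card_eq_0_iff)
  \<comment> \<open>Any nonzero element of \<open>T\<^sub>p\<close> can play the role of
    \<open>t\<close>; a basis vector is at hand.\<close>
  then have "Poly_Mapping.single l 1 \<in> strand p" by (simp add: tensor_comp_def free_mod_def)
  from choose_le_card_strand[OF this] show ?thesis unfolding strand_betti by simp
qed

end
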